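(* Let $C^-_{111}$ be the anti-Jordan quadruple system over $\mathbb{Q}$ of all $3\times3$ matrices $\begin{bmatrix} 0 & 0 & z \\ x & 0 & 0 \\ 0 & y & 0 \end{bmatrix}$ ($x,y,z\in\mathbb{Q}$) under the anti-tetrad $[a,b,c,d]=abcd-dcba$. Then its universal associative envelope satisfies $U(C^-_{111})\cong\mathbb{Q}\oplus M_3(\mathbb{Q})\oplus M_3(\mathbb{Q})$ as associative algebras, and hence, up to isomorphism, $C^-_{111}$ has only three finite dimensional irreducible representations: the 1-dimensional trivial representation, the 3-dimensional natural representation, and another 3-dimensional representation.
   Context: Let $J$ be a subspace of a matrix algebra over $\mathbb{Q}$ closed under the anti-tetrad, with basis $B$. Its universal associative envelope is $U(J)=\mathbb{Q}\langle B\rangle/I(G)$, where $\mathbb{Q}\langle B\rangle$ is the free unital associative algebra on $B$ and $I(G)$ is the two-sided ideal generated by the elements $abcd-dcba-[a,b,c,d]$ for $a,b,c,d\in B$, with $[a,b,c,d]\in J$ computed in $J$ and written as a linear combination of $B$. A representation of $J$ on a vector space $V$ is a linear map $\rho\colon J\to\mathrm{End}(V)$ with $\rho([a,b,c,d])=\rho(a)\rho(b)\rho(c)\rho(d)-\rho(d)\rho(c)\rho(b)\rho(a)$; equivalently, a unital left $U(J)$-module. The trivial representation is $\rho=0$ on a 1-dimensional space; the natural representation is the inclusion of $J$ in the matrix algebra acting on column vectors. *)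

theory Defs
  imports
    "HOL-Analysis.Cartesian_Space"
    "HOL-Library.Poly_Mapping"
    "HOL-Algebra.Module"
    "HOL-Algebra.QuotRing"
    "HOL-Algebra.Chinese_Remainder"
begin

section \<open>Algebras over the rationals\<close>

text \<open>A \<open>\<rat>\<close>-algebra is a record of type \<open>(rat, 'a) module\<close>: a ring record
  with a scalar multiplication.\<close>

definition is_alg_iso ::
    "(rat, 'a) module \<Rightarrow> (rat, 'b) module \<Rightarrow> ('a \<Rightarrow> 'b) \<Rightarrow> bool" where
  "is_alg_iso A A' h \<longleftrightarrow> h \<in> ring_iso A A' \<and>
     (\<forall>q. \<forall>x\<in>carrier A. h (q \<odot>\<^bsub>A\<^esub> x) = q \<odot>\<^bsub>A'\<^esub> h x)"

definition alg_isomorphic :: "(rat, 'a) module \<Rightarrow> (rat, 'b) module \<Rightarrow> bool" where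
  "alg_isomorphic A A' \<longleftrightarrow> (\<exists>h. is_alg_iso A A' h)"

definition alg_sum ::
    "(rat, 'a) module \<Rightarrow> (rat, 'b) module \<Rightarrow> (rat, 'a \<times> 'b) module" where
  "alg_sum A A' = ring.extend (RDirProd A A')
     \<lparr>smult = (\<lambda>q (x, y). (q \<odot>\<^bsub>A\<^esub> x, q \<odot>\<^bsub>A'\<^esub> y))\<rparr>"

definition alg_quot :: "(rat, 'a) module \<Rightarrow> 'a set \<Rightarrow> (rat, 'a set) module" where
  "alg_quot A I = ring.extend (A Quot I)
     \<lparr>smult = (\<lambda>q X. \<Union>x\<in>X. I +>\<^bsub>A\<^esub> (q \<odot>\<^bsub>A\<^esub> x))\<rparr>"

definition rat_alg :: "(rat, rat) module" where
  "rat_alg = \<lparr>carrier = UNIV, mult = (*), one = 1, zero = 0, add = (+), smult = (*)\<rparr>"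

text \<open>On \<open>rat^'n^'n\<close> the class operation \<open>*\<close> is entrywise and \<open>*s\<close> has scalars in
  \<open>rat^'n\<close>, so the scalar multiplication of matrices is defined here.\<close>

definition mat_scale :: "rat \<Rightarrow> rat^'n^'m \<Rightarrow> rat^'n^'m" where
  "mat_scale q A = (\<chi> i j. q * A $ i $ j)"

interpretation matQ: vector_space "mat_scale :: rat \<Rightarrow> rat^'n^'m \<Rightarrow> rat^'n^'m"
  by unfold_locales (simp_all add: mat_scale_def vec_eq_iff algebra_simps)

definition mat_alg :: "(rat, rat^'n^'n) module" where
  "mat_alg = \<lparr>carrier = UNIV, mult = (**), one = mat 1, zero = 0, add = (+), smult = mat_scale\<rparr>"


section \<open>Free unital associative algebras\<close>

text \<open>Words over an alphabet, with concatenation written additively so that the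
  multiplication of \<open>'a word \<Rightarrow>\<^sub>0 rat\<close> supplied by \<open>Poly_Mapping\<close> is the bilinear
  extension of concatenation.\<close>

datatype 'a word = Word (letters: "'a list")

instantiation word :: (type) monoid_add
begin

definition zero_word :: "'a word" where
  "0 = Word []"

definition plus_word :: "'a word \<Rightarrow> 'a word \<Rightarrow> 'a word" where
  "u + v = Word (letters u @ letters v)"

instance
  by intro_classes (simp_all add: zero_word_def plus_word_def)

end

definition free_alg :: "'a set \<Rightarrow> (rat, 'a word \<Rightarrow>\<^sub>0 rat) module" where
  "free_alg B =
     \<lparr>carrier = {p. \<forall>w\<in>Poly_Mapping.keys p. set (letters w) \<subseteq> B},
      mult = (*), one = 1, zero = 0, add = (+),
      smult = (\<lambda>q. Poly_Mapping.map ((*) q))\<rparr>"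

definition gen :: "'a \<Rightarrow> 'a word \<Rightarrow>\<^sub>0 rat" where
  "gen b = Poly_Mapping.single (Word [b]) 1"


section \<open>The anti-tetrad and universal associative envelopes\<close>

definition antitetrad ::
    "rat^'n^'n \<Rightarrow> rat^'n^'n \<Rightarrow> rat^'n^'n \<Rightarrow> rat^'n^'n \<Rightarrow> rat^'n^'n" where
  "antitetrad a b c d = a ** b ** c ** d - d ** c ** b ** a"

definition antitetrad_closed_subspace :: "(rat^'n^'n) set \<Rightarrow> bool" where
  "antitetrad_closed_subspace J \<longleftrightarrow> matQ.subspace J \<and>
     (\<forall>a\<in>J. \<forall>b\<in>J. \<forall>c\<in>J. \<forall>d\<in>J. antitetrad a b c d \<in> J)"

text \<open>The coordinates of \<open>x\<close> with respect to the basis \<open>B\<close> become coefficients of the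
  generators of the free algebra; only meaningful for independent \<open>B\<close> with \<open>x\<close> in its span.\<close>

definition lin_gen :: "(rat^'n^'n) set \<Rightarrow> rat^'n^'n \<Rightarrow> (rat^'n^'n) word \<Rightarrow>\<^sub>0 rat" where
  "lin_gen B x = (\<Sum>b\<in>B. matQ.representation B x b \<odot>\<^bsub>free_alg B\<^esub> gen b)"

definition env_relators :: "(rat^'n^'n) set \<Rightarrow> ((rat^'n^'n) word \<Rightarrow>\<^sub>0 rat) set" where
  "env_relators B =
     {gen a * gen b * gen c * gen d - gen d * gen c * gen b * gen a
        - lin_gen B (antitetrad a b c d) | a b c d. a \<in> B \<and> b \<in> B \<and> c \<in> B \<and> d \<in> B}"

definition univ_env :: "(rat^'n^'n) set \<Rightarrow> (rat, ((rat^'n^'n) word \<Rightarrow>\<^sub>0 rat) set) module" where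
  "univ_env B = alg_quot (free_alg B) (Idl\<^bsub>free_alg B\<^esub> (env_relators B))"


section \<open>Representations\<close>

text \<open>The representation space is the whole type \<open>'v\<close>, with scalar multiplication \<open>s\<close>.
  Only the values of \<open>\<rho>\<close> on \<open>J\<close> matter.\<close>

definition is_rep ::
    "(rat^'n^'n) set \<Rightarrow> (rat \<Rightarrow> 'v \<Rightarrow> 'v) \<Rightarrow> (rat^'n^'n \<Rightarrow> 'v \<Rightarrow> 'v::ab_group_add) \<Rightarrow> bool" where
  "is_rep J s \<rho> \<longleftrightarrow> vector_space s \<and>
     (\<forall>x\<in>J. Vector_Spaces.linear s s (\<rho> x)) \<and>
     (\<forall>x\<in>J. \<forall>y\<in>J. \<forall>v. \<rho> (x + y) v = \<rho> x v + \<rho> y v) \<and>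
     (\<forall>q. \<forall>x\<in>J. \<forall>v. \<rho> (mat_scale q x) v = s q (\<rho> x v)) \<and>
     (\<forall>a\<in>J. \<forall>b\<in>J. \<forall>c\<in>J. \<forall>d\<in>J. \<forall>v.
        \<rho> (antitetrad a b c d) v = \<rho> a (\<rho> b (\<rho> c (\<rho> d v))) - \<rho> d (\<rho> c (\<rho> b (\<rho> a v))))"

definition irreducible_rep ::
    "(rat^'n^'n) set \<Rightarrow> (rat \<Rightarrow> 'v \<Rightarrow> 'v) \<Rightarrow> (rat^'n^'n \<Rightarrow> 'v \<Rightarrow> 'v::ab_group_add) \<Rightarrow> bool" where
  "irreducible_rep J s \<rho> \<longleftrightarrow> is_rep J s \<rho> \<and> (\<exists>v::'v. v \<noteq> 0) \<and>
     (\<forall>W. module.subspace s W \<and> (\<forall>x\<in>J. \<forall>w\<in>W. \<rho> x w \<in> W) \<longrightarrow> W = {0} \<or> W = UNIV)"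

definition rep_isomorphic ::
    "(rat^'n^'n) set \<Rightarrow> (rat \<Rightarrow> 'v \<Rightarrow> 'v) \<Rightarrow> (rat^'n^'n \<Rightarrow> 'v \<Rightarrow> 'v::ab_group_add)
      \<Rightarrow> (rat \<Rightarrow> 'w \<Rightarrow> 'w) \<Rightarrow> (rat^'n^'n \<Rightarrow> 'w \<Rightarrow> 'w::ab_group_add) \<Rightarrow> bool" where
  "rep_isomorphic J s \<rho> s' \<rho>' \<longleftrightarrow>
     (\<exists>T. Vector_Spaces.linear s s' T \<and> bij T \<and> (\<forall>x\<in>J. \<forall>v. T (\<rho> x v) = \<rho>' x (T v)))"

definition trivial_rep :: "rat^'n^'n \<Rightarrow> rat \<Rightarrow> rat" where
  "trivial_rep x v = 0"

definition natural_rep :: "rat^'n^'n \<Rightarrow> rat^'n \<Rightarrow> rat^'n" where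
  "natural_rep x v = x *v v"


section \<open>The system $C^-_{111}$\<close>

definition C111 :: "(rat^3^3) set" where
  "C111 = {vector [vector [0, 0, z],
                   vector [x, 0, 0],
                   vector [0, y, 0]] | x y z. True}"

lemma mem_C111_iff:
  "A \<in> C111 \<longleftrightarrow> A$1$1 = 0 \<and> A$1$2 = 0 \<and> A$2$2 = 0 \<and> A$2$3 = 0 \<and> A$3$1 = 0 \<and> A$3$3 = 0"
  by (auto simp: C111_def vec_eq_iff forall_3)

lemma antitetrad_closed_subspace_C111: "antitetrad_closed_subspace C111"
  by (auto simp: antitetrad_closed_subspace_def matQ.subspace_def mem_C111_iff mat_scale_def
      antitetrad_def matrix_matrix_mult_def sum_3)

end

theory Submission
  imports Defs
begin

text \<open>
  Let \<open>a = E(2,1)\<close>, \<open>b = E(3,2)\<close>, \<open>c = E(1,3)\<close>. The relations say that a word of length four in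
  \<open>a, b, c\<close> equals its reversal, except that \<open>acba = abca + a\<close>, \<open>cbac = cabc + c\<close> and
  \<open>bacb = bcab + b\<close>. Closed chains of such rewritings of words of length six yield
  \<open>aba = 0\<close> and \<open>baa = 0\<close>, and by symmetry all \<open>xyx\<close> and \<open>xyy\<close>; multiplying \<open>acba = abca + a\<close>
  by \<open>a\<close> then gives \<open>aa = 0\<close>. Consequently the words \<open>ba\<close>, \<open>cba\<close>, \<open>acba\<close> and their cyclic images
  behave under left multiplication like the nine matrix units of the natural representation
  \<open>x \<mapsto> x\<close>, and the words running in the opposite direction behave, up to sign, like those of
  \<open>x \<mapsto> -x\<^sup>T\<close>. Together with \<open>1\<close> these words span the envelope, so evaluation in
  \<open>\<rat> \<oplus> M\<^sub>3(\<rat>) \<oplus> M\<^sub>3(\<rat>)\<close> is injective. In an irreducible representation, some column of matrix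
  units acting on a vector is nonzero and intertwines with one of the two three-dimensional
  representations, or else the representation vanishes.
\<close>

section \<open>Consequences of the tetrad relations in a ring\<close>

text \<open>Normal form for indices: offsets reduce to 0, 1 or 2 and subtracting 1 or 2 becomes an
  addition, so that simplification decides cyclic index identities.\<close>

lemma index_mod_3 [simp]: "(3::3) = 0" "(4::3) = 1" "(x::3) - 1 = x + 2" "(x::3) - 2 = x + 1"
  by (simp_all add: algebra_simps)

lemma index_cases: "(i::3) = j \<or> i = j + 1 \<or> i = j + 2"
  using exhaust_3[of i] exhaust_3[of j] by (elim disjE) simp_all

lemma reflect_index_eq: "- (i::3) = 2 - k \<longleftrightarrow> i = k + 1"
  using exhaust_3[of i] exhaust_3[of k] by (elim disjE) (simp_all only:, simp_all)

text \<open>With \<open>g k\<close> in the role of the matrix unit \<open>E(k + 1, k)\<close>, this is \<open>E(i, j)\<close> written as a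
  word in the generators. Indices live in the type \<open>3\<close>, whose arithmetic is modulo 3.\<close>

definition cyc_unit :: "('a, 'm) ring_scheme \<Rightarrow> (3 \<Rightarrow> 'a) \<Rightarrow> 3 \<Rightarrow> 3 \<Rightarrow> 'a" where
  "cyc_unit R g i j =
     (if i = j then g (j + 2) \<otimes>\<^bsub>R\<^esub> (g (j + 1) \<otimes>\<^bsub>R\<^esub> g j)
      else if i = j + 1 then g j \<otimes>\<^bsub>R\<^esub> (g (j + 2) \<otimes>\<^bsub>R\<^esub> (g (j + 1) \<otimes>\<^bsub>R\<^esub> g j))
      else g (j + 1) \<otimes>\<^bsub>R\<^esub> g j)"

lemma (in ring) cyc_unit_in_carrier: "(\<And>k. g k \<in> carrier R) \<Longrightarrow> cyc_unit R g i j \<in> carrier R"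
  by (simp add: cyc_unit_def)

text \<open>Scalars are left out so that the consequences apply both to the quotient of the free
  algebra and to additive endomorphisms of a representation space. With \<open>g k\<close> read as
  E(k + 1, k), the index patterns excluded in \<open>tetrad_sym\<close> are those where the word or
  its reversal has a nonzero matrix product.\<close>

locale cyclic_tetrad = ring R for R (structure) +
  fixes g :: "3 \<Rightarrow> 'a"
  assumes g_closed [simp, intro]: "g i \<in> carrier R"
    and tetrad_cyclic: "g i \<otimes> (g (i + 2) \<otimes> (g (i + 1) \<otimes> g i)) =
      g i \<otimes> (g (i + 1) \<otimes> (g (i + 2) \<otimes> g i)) \<oplus> g i"
    and tetrad_sym: "\<lbrakk>\<not> (i = j + 1 \<and> j = k + 1 \<and> k = l + 1); \<not> (l = k + 1 \<and> k = j + 1 \<and> j = i + 1)\<rbrakk> \<Longrightarrow>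
       g i \<otimes> (g j \<otimes> (g k \<otimes> g l)) = g l \<otimes> (g k \<otimes> (g j \<otimes> g i))"
begin

section \<open>Vanishing short words\<close>

lemma sandwich_succ: "g i \<otimes> (g (i + 1) \<otimes> g i) = \<zero>"
proof -
  define a b c where "a = g i" and "b = g (i + 1)" and "c = g (i + 2)"
  have [simp, intro]: "a \<in> carrier R" "b \<in> carrier R" "c \<in> carrier R"
    by (auto simp: a_def b_def c_def)
  have acba: "a \<otimes> (c \<otimes> (b \<otimes> a)) = a \<otimes> (b \<otimes> (c \<otimes> a)) \<oplus> a"
    using tetrad_cyclic[of i] by (simp add: a_def b_def c_def)
  have bacb: "b \<otimes> (a \<otimes> (c \<otimes> b)) = b \<otimes> (c \<otimes> (a \<otimes> b)) \<oplus> b"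
    using tetrad_cyclic[of "i + 1"] by (simp add: a_def b_def c_def add.assoc)
  have babc: "b \<otimes> (a \<otimes> (b \<otimes> c)) = c \<otimes> (b \<otimes> (a \<otimes> b))"
    unfolding a_def b_def c_def by (rule tetrad_sym) auto
  \<comment> \<open>The closed chain is
    \<open>ababca = acbaba = abcaba + aba = abacba = ababca + aba\<close>. It uses
    \<open>babc = cbab\<close>, then the cyclic relations at \<open>a\<close>, at \<open>b\<close>
    and again at \<open>a\<close>; cancelling \<open>s\<close> leaves \<open>u = 0\<close>.\<close>
  define s t u where "s = a \<otimes> (b \<otimes> (a \<otimes> (b \<otimes> (c \<otimes> a))))"
    and "t = a \<otimes> (b \<otimes> (c \<otimes> (a \<otimes> (b \<otimes> a))))" and "u = a \<otimes> (b \<otimes> a)"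
  have closed: "s \<in> carrier R" "t \<in> carrier R" "u \<in> carrier R"
    by (simp_all add: s_def t_def u_def)
  have "s = (a \<otimes> (b \<otimes> (a \<otimes> (b \<otimes> c)))) \<otimes> a"
    by (simp add: s_def m_assoc)
  also have "\<dots> = (a \<otimes> (c \<otimes> (b \<otimes> a))) \<otimes> (b \<otimes> a)"
    by (subst babc) (simp add: m_assoc)
  also have "\<dots> = t \<oplus> u"
    by (subst acba) (simp add: m_assoc l_distr t_def u_def)
  finally have st: "s = t \<oplus> u" .
  have "t \<oplus> u = a \<otimes> (b \<otimes> (c \<otimes> (a \<otimes> b)) \<oplus> b) \<otimes> a"
    by (simp add: t_def u_def m_assoc l_distr r_distr)
  also have "\<dots> = a \<otimes> (b \<otimes> (a \<otimes> (c \<otimes> (b \<otimes> a))))"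
    by (subst bacb[symmetric]) (simp add: m_assoc)
  also have "\<dots> = s \<oplus> u"
    by (subst acba) (simp add: r_distr s_def u_def)
  finally have "s = s \<oplus> u"
    using st by simp
  then show ?thesis
    using closed add.l_cancel_one'[of s u] by (simp add: u_def a_def b_def)
qed

text \<open>The closed chain is \<open>aaabbc = baaabc = bacbaa = bcabaa + baa\<close>, where
  \<open>bcabaa = bcaaba = aacbba = aaabbc\<close>. Only the step through \<open>bacb\<close> is
  cyclic and leaves the extra term \<open>baa\<close>; all others are plain reversals.\<close>

lemma succ_square: "g (i + 1) \<otimes> (g i \<otimes> g i) = \<zero>"
proof -
  define a b c where "a = g i" and "b = g (i + 1)" and "c = g (i + 2)"
  have [simp, intro]: "a \<in> carrier R" "b \<in> carrier R" "c \<in> carrier R"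
    by (auto simp: a_def b_def c_def)
  have bacb: "b \<otimes> (a \<otimes> (c \<otimes> b)) = b \<otimes> (c \<otimes> (a \<otimes> b)) \<oplus> b"
    using tetrad_cyclic[of "i + 1"] by (simp add: a_def b_def c_def add.assoc)
  have sym:
    "a \<otimes> (a \<otimes> (a \<otimes> b)) = b \<otimes> (a \<otimes> (a \<otimes> a))"
    "a \<otimes> (a \<otimes> (b \<otimes> c)) = c \<otimes> (b \<otimes> (a \<otimes> a))"
    "a \<otimes> (b \<otimes> (a \<otimes> a)) = a \<otimes> (a \<otimes> (b \<otimes> a))"
    "b \<otimes> (c \<otimes> (a \<otimes> a)) = a \<otimes> (a \<otimes> (c \<otimes> b))"
    "a \<otimes> (b \<otimes> (b \<otimes> c)) = c \<otimes> (b \<otimes> (b \<otimes> a))"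
    unfolding a_def b_def c_def by (rule tetrad_sym; simp)+
  define s u where "s = a \<otimes> (a \<otimes> (a \<otimes> (b \<otimes> (b \<otimes> c))))" and "u = b \<otimes> (a \<otimes> a)"
  have closed: "s \<in> carrier R" "u \<in> carrier R"
    by (simp_all add: s_def u_def)
  have "s = (a \<otimes> (a \<otimes> (a \<otimes> b))) \<otimes> (b \<otimes> c)"
    by (simp add: s_def m_assoc)
  also have "\<dots> = b \<otimes> (a \<otimes> (a \<otimes> (a \<otimes> (b \<otimes> c))))"
    by (subst sym) (simp add: m_assoc)
  also have "\<dots> = (b \<otimes> (a \<otimes> (c \<otimes> b))) \<otimes> (a \<otimes> a)"
    by (subst sym) (simp add: m_assoc)
  also have "\<dots> = b \<otimes> (c \<otimes> (a \<otimes> (b \<otimes> (a \<otimes> a)))) \<oplus> u"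
    by (subst bacb) (simp add: m_assoc l_distr u_def)
  also have "b \<otimes> (c \<otimes> (a \<otimes> (b \<otimes> (a \<otimes> a)))) = (b \<otimes> (c \<otimes> (a \<otimes> a))) \<otimes> (b \<otimes> a)"
    by (subst sym) (simp add: m_assoc)
  also have "\<dots> = a \<otimes> (a \<otimes> (c \<otimes> (b \<otimes> (b \<otimes> a))))"
    by (subst sym) (simp add: m_assoc)
  also have "\<dots> = s"
    by (subst sym(5)[symmetric]) (simp add: s_def)
  finally have "s = s \<oplus> u" .
  then show ?thesis
    using closed add.l_cancel_one'[of s u] by (simp add: u_def a_def b_def)
qed

text \<open>Reflecting the indices swaps the two words of a cyclic relation. The four signs of a
  word cancel while the linear term keeps its sign, which is what moving it to the other side
  requires.\<close>

lemma cyclic_tetrad_reflect: "cyclic_tetrad R (\<lambda>k. \<ominus> g (2 - k))"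
proof
  fix i j k l :: 3
  show "\<ominus> g (2 - i) \<in> carrier R" by simp
  define x y z where "x = g (2 - i)" and "y = g (2 - (i + 1))" and "z = g (2 - (i + 2))"
  have [simp, intro]: "x \<in> carrier R" "y \<in> carrier R" "z \<in> carrier R"
    by (auto simp: x_def y_def z_def)
  have "2 - i + 2 = 2 - (i + 1)" "2 - i + 1 = 2 - (i + 2)"
    by (simp_all add: algebra_simps)
  then have "x \<otimes> (y \<otimes> (z \<otimes> x)) = x \<otimes> (z \<otimes> (y \<otimes> x)) \<oplus> x"
    using tetrad_cyclic[of "2 - i"] by (simp only: x_def y_def z_def)
  then have "\<ominus> x \<otimes> (\<ominus> z \<otimes> (\<ominus> y \<otimes> \<ominus> x)) = \<ominus> x \<otimes> (\<ominus> y \<otimes> (\<ominus> z \<otimes> \<ominus> x)) \<oplus> \<ominus> x"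
    by (simp add: l_minus r_minus r_neg a_assoc)
  then show "\<ominus> g (2 - i) \<otimes> (\<ominus> g (2 - (i + 2)) \<otimes> (\<ominus> g (2 - (i + 1)) \<otimes> \<ominus> g (2 - i))) =
    \<ominus> g (2 - i) \<otimes> (\<ominus> g (2 - (i + 1)) \<otimes> (\<ominus> g (2 - (i + 2)) \<otimes> \<ominus> g (2 - i))) \<oplus> \<ominus> g (2 - i)"
    by (simp only: x_def y_def z_def)
  assume "\<not> (i = j + 1 \<and> j = k + 1 \<and> k = l + 1)" "\<not> (l = k + 1 \<and> k = j + 1 \<and> j = i + 1)"
  then have "g (2 - i) \<otimes> (g (2 - j) \<otimes> (g (2 - k) \<otimes> g (2 - l))) =
      g (2 - l) \<otimes> (g (2 - k) \<otimes> (g (2 - j) \<otimes> g (2 - i)))"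
    by (intro tetrad_sym) (auto simp: algebra_simps)
  then show "\<ominus> g (2 - i) \<otimes> (\<ominus> g (2 - j) \<otimes> (\<ominus> g (2 - k) \<otimes> \<ominus> g (2 - l))) =
      \<ominus> g (2 - l) \<otimes> (\<ominus> g (2 - k) \<otimes> (\<ominus> g (2 - j) \<otimes> \<ominus> g (2 - i)))"
    by (simp add: l_minus r_minus)
qed

text \<open>Mirror image of \<open>succ_square\<close>: the reflection turns successors into
  predecessors.\<close>

lemma pred_square: "g (i + 2) \<otimes> (g i \<otimes> g i) = \<zero>"
proof -
  interpret refl: cyclic_tetrad R "\<lambda>k. \<ominus> g (2 - k)"
    by (rule cyclic_tetrad_reflect)
  show ?thesis
    using refl.succ_square[of "2 - i"] by (simp add: l_minus r_minus add.commute)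
qed

lemma square: "g i \<otimes> g i = \<zero>"
proof -
  have "(g i \<otimes> (g (i + 2) \<otimes> (g (i + 1) \<otimes> g i))) \<otimes> g i =
      (g i \<otimes> (g (i + 1) \<otimes> (g (i + 2) \<otimes> g i)) \<oplus> g i) \<otimes> g i"
    by (simp only: tetrad_cyclic)
  then show ?thesis
    by (simp add: m_assoc l_distr succ_square pred_square)
qed

text \<open>Multiply the cyclic relation at \<open>i + 2\<close> on the right by
  \<open>g (i + 1)\<close>; the second word then ends in a sandwich and vanishes. A full turn around
  the cycle can thus be removed from a word.\<close>

lemma tetrad_cyclic_left: "g (i + 2) \<otimes> (g (i + 1) \<otimes> (g i \<otimes> (g (i + 2) \<otimes> g (i + 1)))) = g (i + 2) \<otimes> g (i + 1)"
proof -
  have "g (i + 2) \<otimes> (g (i + 1) \<otimes> (g i \<otimes> g (i + 2))) = g (i + 2) \<otimes> (g i \<otimes> (g (i + 1) \<otimes> g (i + 2))) \<oplus> g (i + 2)"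
    using tetrad_cyclic[of "i + 2"] by (simp add: add.assoc)
  then have "(g (i + 2) \<otimes> (g (i + 1) \<otimes> (g i \<otimes> g (i + 2)))) \<otimes> g (i + 1) =
      (g (i + 2) \<otimes> (g i \<otimes> (g (i + 1) \<otimes> g (i + 2))) \<oplus> g (i + 2)) \<otimes> g (i + 1)"
    by simp
  then show ?thesis
    using sandwich_succ[of "i + 1"] by (simp add: m_assoc l_distr add.assoc)
qed

section \<open>Action of the generators on the two families of units\<close>

lemma square_left: "x \<in> carrier R \<Longrightarrow> g i \<otimes> (g i \<otimes> x) = \<zero>"
  using square[of i] by (simp add: m_assoc[symmetric])

lemma sandwich_succ_left: "x \<in> carrier R \<Longrightarrow> g i \<otimes> (g (i + 1) \<otimes> (g i \<otimes> x)) = \<zero>"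
  using arg_cong[OF sandwich_succ[of i], of "\<lambda>y. y \<otimes> x"] by (simp add: m_assoc)

text \<open>Within column \<open>j\<close>, two of the three nonzero products merely lengthen the
  word. The third, from row \<open>j + 1\<close> to row \<open>j + 2\<close>, gives a word of length
  five that \<open>tetrad_cyclic_left\<close> shortens to length two. All remaining products begin
  with a square or a sandwich.\<close>

lemma gen_mult_cyc_unit: "g k \<otimes> cyc_unit R g i j = (if i = k then cyc_unit R g (k + 1) j else \<zero>)"
proof -
  have *: "g (j + 1) \<otimes> (g j \<otimes> (g (j + 2) \<otimes> (g (j + 1) \<otimes> g j))) = g (j + 1) \<otimes> g j"
    using tetrad_cyclic_left[of "j + 2"] by (simp add: add.assoc)
  have **: "g (j + 1) \<otimes> (g (j + 2) \<otimes> (g (j + 1) \<otimes> g j)) = \<zero>"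
    using sandwich_succ_left[of "g j" "j + 1"] by (simp add: add.assoc)
  have ***: "g (j + 2) \<otimes> (g j \<otimes> (g (j + 2) \<otimes> (g (j + 1) \<otimes> g j))) = \<zero>"
    using sandwich_succ_left[of "g (j + 1) \<otimes> g j" "j + 2"] by (simp add: add.assoc)
  have neq: "j + 1 \<noteq> j" "j + 2 \<noteq> j" "j + 2 \<noteq> j + 1" "j + 1 + 1 = j + 2" "j + 2 + 1 = j"
    by (simp_all add: add.assoc)
  consider "i = j" | "i = j + 1" | "i = j + 2" using index_cases by blast
  then show ?thesis
  proof cases
    case 1
    then show ?thesis using index_cases[of k j] neq
      by (elim disjE) (simp_all add: cyc_unit_def square_left **)
  next
    case 2
    then show ?thesis using index_cases[of k j] neq
      by (elim disjE) (simp_all add: cyc_unit_def square_left * ***)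
  next
    case 3
    then show ?thesis using index_cases[of k j] neq
      by (elim disjE) (simp_all add: cyc_unit_def square_left sandwich_succ)
  qed
qed

lemma cyc_unit_closed [simp, intro]: "cyc_unit R g i j \<in> carrier R"
  by (rule cyc_unit_in_carrier) simp

text \<open>The relations are invariant under \<open>g k \<mapsto> - g (2 - k)\<close>, an automorphism that
  interchanges the two matrix blocks; hence every identity for the second block is the mirror
  image of one for the first.\<close>

definition cocyc_unit where
  "cocyc_unit = (\<lambda>i j. cyc_unit R (\<lambda>k. \<ominus> g (2 - k)) (- i) (- j))"

lemma cocyc_unit_closed [simp, intro]: "cocyc_unit i j \<in> carrier R"
  by (simp add: cocyc_unit_def cyc_unit_def)

text \<open>Here \<open>g k\<close> acts as the negative of E(k, k + 1), the negative transpose of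
  E(k + 1, k).\<close>

lemma gen_mult_cocyc_unit:
  "g k \<otimes> cocyc_unit i j = (if i = k + 1 then \<ominus> cocyc_unit k j else \<zero>)"
proof -
  interpret refl: cyclic_tetrad R "\<lambda>k. \<ominus> g (2 - k)"
    by (rule cyclic_tetrad_reflect)
  have eqs: "2 - k + 1 = - k" "2 - (2 - k) = k" "- i = 2 - k \<longleftrightarrow> i = k + 1"
    by (simp add: algebra_simps, simp, rule reflect_index_eq)
  have "\<ominus> g k \<otimes> cocyc_unit i j = (if i = k + 1 then cocyc_unit k j else \<zero>)"
    using refl.gen_mult_cyc_unit[of "2 - k" "- i" "- j"] unfolding eqs cocyc_unit_def .
  then have "\<ominus> (\<ominus> g k \<otimes> cocyc_unit i j) = \<ominus> (if i = k + 1 then cocyc_unit k j else \<zero>)"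
    by (rule arg_cong)
  then show ?thesis
    by (simp add: l_minus split: if_splits)
qed

text \<open>The two units are the words of length four in the cyclic relation, so their difference
  is the linear term of that relation.\<close>

lemma gen_decomp: "g k = cyc_unit R g (k + 1) k \<ominus> cocyc_unit k (k + 1)"
proof -
  have eqs: "2 - - (k + 1) = k" "2 - (- (k + 1) + 2) = k + 1" "2 - - k = k + 2"
    "- k \<noteq> - (k + 1)" "- (k + 1) + 1 = - k"
    by (simp_all add: algebra_simps)
  have "cocyc_unit k (k + 1) = \<ominus> g k \<otimes> (\<ominus> g (k + 1) \<otimes> (\<ominus> g (k + 2) \<otimes> \<ominus> g k))"
    by (simp only: cocyc_unit_def cyc_unit_def eqs if_False if_True simp_thms)
  then have "cocyc_unit k (k + 1) = g k \<otimes> (g (k + 1) \<otimes> (g (k + 2) \<otimes> g k))"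
    by (simp add: l_minus r_minus)
  moreover have "x \<oplus> g k \<ominus> x = g k" if "x \<in> carrier R" for x
    using that by (simp add: a_minus_def a_comm[of x] a_assoc r_neg)
  ultimately show ?thesis
    using tetrad_cyclic[of k] by (simp add: cyc_unit_def)
qed

end

section \<open>Matrix units and representations\<close>

definition mat_unit :: "3 \<Rightarrow> 3 \<Rightarrow> rat^3^3" where
  "mat_unit i j = (\<chi> r c. if r = i \<and> c = j then 1 else 0)"

abbreviation cyc_mat :: "3 \<Rightarrow> rat^3^3" where
  "cyc_mat k \<equiv> mat_unit (k + 1) k"

lemma mat_unit_mult: "mat_unit i j ** mat_unit k l = (if j = k then mat_unit i l else 0)"
  by (simp add: mat_unit_def matrix_matrix_mult_def vec_eq_iff if_distrib[of "\<lambda>x. x * _"] cong: if_cong)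

lemma mat_unit_mult_vec: "mat_unit i j *v v = v $ j *s axis i 1"
  by (auto simp: mat_unit_def matrix_vector_mult_def vec_eq_iff axis_def if_distrib[of "\<lambda>x. x * _"] cong: if_cong)

lemma transpose_mat_unit [simp]: "transpose (mat_unit i j) = mat_unit j i"
  by (auto simp: mat_unit_def transpose_def vec_eq_iff)

lemma cyc_mat_in_C111 [simp, intro]: "cyc_mat k \<in> C111"
  using exhaust_3[of k] by (auto simp: mem_C111_iff mat_unit_def)

lemma matrix_mult_zero [simp]: "A ** 0 = (0 :: rat^'n^'m)" "0 ** A = (0 :: rat^'n^'m)"
  by (simp_all add: matrix_matrix_mult_def vec_eq_iff)

lemma antitetrad_cyclic: "antitetrad (cyc_mat i) (cyc_mat (i + 2)) (cyc_mat (i + 1)) (cyc_mat i) = cyc_mat i"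
  by (simp add: antitetrad_def mat_unit_mult add.assoc)

lemma antitetrad_sym:
  assumes "\<not> (i = j + 1 \<and> j = k + 1 \<and> k = l + 1)" "\<not> (l = k + 1 \<and> k = j + 1 \<and> j = i + 1)"
  shows "antitetrad (cyc_mat i) (cyc_mat j) (cyc_mat k) (cyc_mat l) = 0"
  using assms by (auto simp: antitetrad_def mat_unit_mult)

text \<open>Common entry point for the quotient of the free algebra and for representations. The
  reversed word is moved to the right-hand side so that the relation is expressed by sums and
  products of \<open>R\<close> alone.\<close>

lemma cyclic_tetradI:
  assumes "ring R"
    and closed: "\<And>x. x \<in> C111 \<Longrightarrow> \<rho> x \<in> carrier R"
    and zero: "\<rho> 0 = \<zero>\<^bsub>R\<^esub>"
    and tetrad: "\<And>a b c d. \<lbrakk>a \<in> C111; b \<in> C111; c \<in> C111; d \<in> C111\<rbrakk> \<Longrightarrow>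
      \<rho> a \<otimes>\<^bsub>R\<^esub> (\<rho> b \<otimes>\<^bsub>R\<^esub> (\<rho> c \<otimes>\<^bsub>R\<^esub> \<rho> d)) =
      \<rho> d \<otimes>\<^bsub>R\<^esub> (\<rho> c \<otimes>\<^bsub>R\<^esub> (\<rho> b \<otimes>\<^bsub>R\<^esub> \<rho> a)) \<oplus>\<^bsub>R\<^esub> \<rho> (antitetrad a b c d)"
  shows "cyclic_tetrad R (\<lambda>k. \<rho> (cyc_mat k))"
proof -
  interpret ring R by fact
  show ?thesis
  proof
    fix i j k l :: 3
    show "\<rho> (cyc_mat i) \<in> carrier R" by (simp add: closed)
    show "\<rho> (cyc_mat i) \<otimes>\<^bsub>R\<^esub> (\<rho> (cyc_mat (i + 2)) \<otimes>\<^bsub>R\<^esub> (\<rho> (cyc_mat (i + 1)) \<otimes>\<^bsub>R\<^esub> \<rho> (cyc_mat i))) =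
      \<rho> (cyc_mat i) \<otimes>\<^bsub>R\<^esub> (\<rho> (cyc_mat (i + 1)) \<otimes>\<^bsub>R\<^esub> (\<rho> (cyc_mat (i + 2)) \<otimes>\<^bsub>R\<^esub> \<rho> (cyc_mat i))) \<oplus>\<^bsub>R\<^esub> \<rho> (cyc_mat i)"
      using tetrad[OF cyc_mat_in_C111 cyc_mat_in_C111 cyc_mat_in_C111 cyc_mat_in_C111,
          of i "i + 2" "i + 1" i] unfolding antitetrad_cyclic .
    assume "\<not> (i = j + 1 \<and> j = k + 1 \<and> k = l + 1)" "\<not> (l = k + 1 \<and> k = j + 1 \<and> j = i + 1)"
    from antitetrad_sym[OF this] tetrad[of "cyc_mat i" "cyc_mat j" "cyc_mat k" "cyc_mat l"]
    show "\<rho> (cyc_mat i) \<otimes>\<^bsub>R\<^esub> (\<rho> (cyc_mat j) \<otimes>\<^bsub>R\<^esub> (\<rho> (cyc_mat k) \<otimes>\<^bsub>R\<^esub> \<rho> (cyc_mat l))) =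
      \<rho> (cyc_mat l) \<otimes>\<^bsub>R\<^esub> (\<rho> (cyc_mat k) \<otimes>\<^bsub>R\<^esub> (\<rho> (cyc_mat j) \<otimes>\<^bsub>R\<^esub> \<rho> (cyc_mat i)))"
      by (simp add: zero closed)
  qed
qed

lemma C111_decomp:
  assumes "x \<in> C111"
  shows "x = (\<Sum>k\<in>UNIV. mat_scale (x $ (k + 1) $ k) (cyc_mat k))"
  using assms
  by (simp add: mem_C111_iff vec_eq_iff forall_3 sum_3 mat_scale_def mat_unit_def)

text \<open>With additive maps in place of linear ones the ring depends on the type alone and not on
  a scalar multiplication.\<close>

definition additive_endo_ring :: "('v::ab_group_add \<Rightarrow> 'v) ring" where
  "additive_endo_ring =
     \<lparr>carrier = {f. \<forall>x y. f (x + y) = f x + f y}, mult = (\<circ>), one = id,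
      zero = (\<lambda>_. 0), add = (\<lambda>f g x. f x + g x)\<rparr>"

lemma ring_additive_endo_ring: "ring (additive_endo_ring :: ('v::ab_group_add \<Rightarrow> 'v) ring)"
proof (intro ringI abelian_groupI monoidI)
  fix f :: "'v \<Rightarrow> 'v"
  assume "f \<in> carrier additive_endo_ring"
  then show "\<exists>g\<in>carrier additive_endo_ring. g \<oplus>\<^bsub>additive_endo_ring\<^esub> f = \<zero>\<^bsub>additive_endo_ring\<^esub>"
    by (intro bexI[of _ "\<lambda>x. - f x"]) (simp_all add: additive_endo_ring_def fun_eq_iff)
qed (auto simp: additive_endo_ring_def fun_eq_iff algebra_simps)

section \<open>The negative transpose and the basic representations\<close>

definition cotranspose :: "rat^'n^'n \<Rightarrow> rat^'n^'n" where
  "cotranspose x = - transpose x"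

lemma cotranspose_add: "cotranspose (x + y) = cotranspose x + cotranspose y"
  by (simp add: cotranspose_def transpose_def vec_eq_iff)

lemma cotranspose_scale: "cotranspose (mat_scale q x) = mat_scale q (cotranspose x)"
  by (simp add: cotranspose_def transpose_def mat_scale_def vec_eq_iff)

lemma matrix_minus_mult: "(- A) ** B = - (A ** B)" "A ** (- B) = - (A ** B)"
  for A :: "rat^'n^'m" and B :: "rat^'k^'n"
  by (simp_all add: matrix_matrix_mult_def vec_eq_iff sum_negf)

text \<open>Transposition reverses products and so negates the anti-tetrad; the outer minus sign
  repairs this, and the four inner ones cancel.\<close>

lemma cotranspose_antitetrad:
  fixes a b c d :: "rat^'n^'n"
  shows
  "cotranspose (antitetrad a b c d) = antitetrad (cotranspose a) (cotranspose b) (cotranspose c) (cotranspose d)"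
proof -
  have "transpose (A - B) = transpose A - transpose B" for A B :: "rat^'n^'n"
    by (simp add: transpose_def vec_eq_iff)
  then show ?thesis
    by (simp add: cotranspose_def antitetrad_def matrix_minus_mult matrix_transpose_mul matrix_mul_assoc)
qed

text \<open>The contragredient of the natural representation; it serves as the second
  three-dimensional representation.\<close>

definition cotranspose_rep :: "rat^'n^'n \<Rightarrow> rat^'n \<Rightarrow> rat^'n" where
  "cotranspose_rep x v = cotranspose x *v v"

lemma mat_scale_mult_vec: "mat_scale q A *v v = q *s (A *v v)" for v :: "rat^'n"
  by (simp add: mat_scale_def matrix_vector_mult_def vec_eq_iff sum_distrib_left mult.assoc)

lemma antitetrad_mult_vec:
  "antitetrad a b c d *v v = a *v (b *v (c *v (d *v v))) - d *v (c *v (b *v (a *v v)))"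
proof -
  have "(A - B) *v v = A *v v - B *v v" for A B
    by (simp add: matrix_vector_mult_def vec_eq_iff sum_subtractf algebra_simps)
  then show ?thesis
    by (simp add: antitetrad_def matrix_vector_mul_assoc matrix_mul_assoc)
qed

lemma is_rep_natural: "is_rep J (*s) (natural_rep :: rat^'n^'n \<Rightarrow> _)"
  unfolding is_rep_def natural_rep_def
  by (auto simp: vec.vector_space_axioms matrix_vector_mul_linear_gen matrix_vector_mult_add_rdistrib
      mat_scale_mult_vec antitetrad_mult_vec)

lemma is_rep_cotranspose: "is_rep J (*s) (cotranspose_rep :: rat^'n^'n \<Rightarrow> _)"
  unfolding is_rep_def cotranspose_rep_def
  by (auto simp: vec.vector_space_axioms matrix_vector_mul_linear_gen matrix_vector_mult_add_rdistrib
      cotranspose_add cotranspose_scale cotranspose_antitetrad mat_scale_mult_vec antitetrad_mult_vec)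

lemma is_rep_trivial: "is_rep J (*) trivial_rep"
  unfolding is_rep_def trivial_rep_def
  by (auto simp: vector_space_over_itself.vector_space_axioms Vector_Spaces.linear_iff)

section \<open>Irreducible representations\<close>

lemma rep_isomorphic_sym:
  assumes "rep_isomorphic J s \<rho> s' \<rho>'"
  shows "rep_isomorphic J s' \<rho>' s \<rho>"
proof -
  obtain T where T: "Vector_Spaces.linear s s' T" "bij T" "\<forall>x\<in>J. \<forall>v. T (\<rho> x v) = \<rho>' x (T v)"
    using assms by (auto simp: rep_isomorphic_def)
  define U where "U = inv_into UNIV T"
  have inv: "T (U w) = w" "U (T v) = v" for v w
    using T(2) by (simp_all add: U_def bij_is_surj surj_f_inv_f bij_is_inj)
  have "Vector_Spaces.linear s' s U"
    using T(1) unfolding Vector_Spaces.linear_iff by (metis inv)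
  moreover have "\<forall>x\<in>J. \<forall>w. U (\<rho>' x w) = \<rho> x (U w)"
    using T(3) by (metis inv)
  ultimately show ?thesis
    using T(2) bij_imp_bij_inv unfolding rep_isomorphic_def U_def by blast
qed

lemma rep_isomorphic_trans:
  assumes "rep_isomorphic J s \<rho> s' \<rho>'" and "rep_isomorphic J s' \<rho>' s'' \<rho>''"
  shows "rep_isomorphic J s \<rho> s'' \<rho>''"
proof -
  obtain T where T: "Vector_Spaces.linear s s' T" "bij T" "\<forall>x\<in>J. \<forall>v. T (\<rho> x v) = \<rho>' x (T v)"
    using assms(1) by (auto simp: rep_isomorphic_def)
  obtain U where U: "Vector_Spaces.linear s' s'' U" "bij U" "\<forall>x\<in>J. \<forall>v. U (\<rho>' x v) = \<rho>'' x (U v)"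
    using assms(2) by (auto simp: rep_isomorphic_def)
  have "Vector_Spaces.linear s s'' (U \<circ> T)" "bij (U \<circ> T)"
    using T U by (auto simp: Vector_Spaces.linear_iff bij_comp)
  then show ?thesis
    using T(3) U(3) unfolding rep_isomorphic_def by (intro exI[of _ "U \<circ> T"]) simp
qed

text \<open>Schur's lemma: kernel and range of \<open>T\<close> are invariant subspaces, and the
  nonzero value rules out a full kernel and a zero range.\<close>

lemma schur_isomorphic:
  assumes irr: "irreducible_rep J s \<rho>" "irreducible_rep J s' \<rho>'"
    and lin: "Vector_Spaces.linear s s' T"
    and comm: "\<And>x v. x \<in> J \<Longrightarrow> T (\<rho> x v) = \<rho>' x (T v)"
    and nonzero: "T v0 \<noteq> 0"
  shows "rep_isomorphic J s \<rho> s' \<rho>'"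
proof -
  interpret T: Vector_Spaces.linear s s' T by fact
  have zero: "f 0 = 0" if "Vector_Spaces.linear t t f" for f :: "'c::ab_group_add \<Rightarrow> 'c" and t :: "rat \<Rightarrow> 'c \<Rightarrow> 'c"
  proof -
    interpret Vector_Spaces.linear t t f by fact
    show ?thesis by simp
  qed
  have rep: "\<And>x. x \<in> J \<Longrightarrow> \<rho>' x 0 = 0"
    using irr(2) zero unfolding irreducible_rep_def is_rep_def by blast
  have irr1: "W = {0} \<or> W = UNIV" if "T.vs1.subspace W" "\<forall>x\<in>J. \<forall>w\<in>W. \<rho> x w \<in> W" for W
    using irr(1) that unfolding irreducible_rep_def by (elim conjE allE[of _ W]) simp
  have irr2: "W = {0} \<or> W = UNIV" if "T.vs2.subspace W" "\<forall>x\<in>J. \<forall>w\<in>W. \<rho>' x w \<in> W" for W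
    using irr(2) that unfolding irreducible_rep_def by (elim conjE allE[of _ W]) simp
  have "{v. T v = 0} = {0} \<or> {v. T v = 0} = UNIV"
    using T.subspace_kernel rep by (intro irr1) (simp_all add: comm)
  moreover have "range T = {0} \<or> range T = UNIV"
    using T.subspace_image[OF T.vs1.subspace_UNIV] by (intro irr2) (auto simp: comm[symmetric])
  moreover have "{v. T v = 0} \<noteq> UNIV" "range T \<noteq> {0}"
    using nonzero by auto
  ultimately have ker: "{v. T v = 0} = {0}" and "surj T"
    by auto
  have "inj T"
    using ker T.inj_iff_eq_0 by auto
  then show ?thesis
    unfolding rep_isomorphic_def using lin comm \<open>surj T\<close> by (auto simp: bij_def)
qed

lemma scaled_cyc_mat_in_C111: "mat_scale q (cyc_mat k) \<in> C111"
  and C111_add: "\<lbrakk>x \<in> C111; y \<in> C111\<rbrakk> \<Longrightarrow> x + y \<in> C111"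
  using cyc_mat_in_C111[of k] by (auto simp: mem_C111_iff mat_scale_def)

lemma rep_C111_decomp:
  assumes "is_rep C111 s \<rho>" "x \<in> C111"
  shows "\<rho> x v = (\<Sum>k\<in>UNIV. s (x $ (k + 1) $ k) (\<rho> (cyc_mat k) v))"
proof -
  define m where "m = (\<lambda>k. cyc_mat k)"
  have x: "x = (\<Sum>k\<in>UNIV. mat_scale (x $ (k + 1) $ k) (m k))"
    using C111_decomp[OF assms(2)] by (simp only: m_def)
  have m: "mat_scale q (m k) \<in> C111" "m k \<in> C111" for q k
    by (simp_all add: m_def scaled_cyc_mat_in_C111)
  have "\<rho> x v = (\<Sum>k\<in>UNIV. s (x $ (k + 1) $ k) (\<rho> (m k) v))"
    using assms(1) unfolding is_rep_def
    by (subst x) (simp add: sum_3 m C111_add)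
  then show ?thesis by (simp only: m_def)
qed

text \<open>Both actions are determined linearly by the three matrices \<open>cyc_mat k\<close>, and
  \<open>T\<close> is linear.\<close>

lemma rep_C111_intertwine:
  assumes "is_rep C111 s \<rho>" "is_rep C111 s' \<rho>'" "Vector_Spaces.linear s s' T"
    and "\<And>k v. T (\<rho> (cyc_mat k) v) = \<rho>' (cyc_mat k) (T v)"
    and "x \<in> C111"
  shows "T (\<rho> x v) = \<rho>' x (T v)"
proof -
  interpret Vector_Spaces.linear s s' T by fact
  show ?thesis
    unfolding rep_C111_decomp[OF assms(1,5)] rep_C111_decomp[OF assms(2,5)] assms(4)[symmetric]
    by (simp only: sum scale)
qed

section \<open>Irreducibility of the three representations\<close>

lemma natural_cyc_mat: "natural_rep (cyc_mat k) v = v $ k *s axis (k + 1) 1"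
  by (simp add: natural_rep_def mat_unit_mult_vec)

lemma cotranspose_cyc_mat: "cotranspose_rep (cyc_mat k) v = - (v $ (k + 1) *s axis k 1)"
proof -
  have "(- A) *v v = - (A *v v)" for A :: "rat^3^3"
    by (simp add: matrix_vector_mult_def vec_eq_iff sum_negf)
  then show ?thesis
    by (simp add: cotranspose_rep_def cotranspose_def mat_unit_mult_vec)
qed

text \<open>A nonzero coordinate of a vector in \<open>W\<close> yields one axis vector after
  rescaling, and a shift by \<open>d\<close> reaches all others since 1 and 2 both generate the
  integers modulo 3. The natural representation has \<open>d = 1\<close>, its contragredient
  \<open>d = 2\<close>.\<close>

lemma shift_invariant_subspace:
  fixes W :: "(rat^3) set"
  assumes W: "vec.subspace W" and d: "d = 1 \<or> d = 2"
    and shift: "\<And>k w. w \<in> W \<Longrightarrow> w $ k *s axis (k + d) 1 \<in> W"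
  shows "W = {0} \<or> W = UNIV"
proof (cases "W \<subseteq> {0}")
  case True
  then show ?thesis using vec.subspace_0[OF W] by blast
next
  case False
  then obtain w where "w \<in> W" "w \<noteq> 0"
    by auto
  then obtain k where w: "w \<in> W" "w $ k \<noteq> 0"
    by (metis vec_eq_iff zero_index)
  have "(1 / w $ k) *s (w $ k *s axis (k + d) 1) \<in> W"
    using vec.subspace_scale[OF W shift[OF w(1)]] .
  then have 1: "axis (k + d) 1 \<in> W"
    using w(2) by simp
  have step: "axis (l + d) 1 \<in> W" if "axis l 1 \<in> W" for l
    using shift[OF that, of l] by simp
  have axes: "axis l 1 \<in> W" for l
    using index_cases[of l k] d 1 step[OF 1] step[OF step[OF 1]] by (auto simp: add.assoc)
  have "v \<in> W" for v
  proof -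
    have "(\<Sum>i\<in>UNIV. v $ i *s axis i 1) \<in> W"
      by (intro vec.subspace_sum[OF W] vec.subspace_scale[OF W] axes)
    then show ?thesis by (simp add: basis_expansion)
  qed
  then show ?thesis by auto
qed

lemma irreducible_natural: "irreducible_rep C111 (*s) natural_rep"
  unfolding irreducible_rep_def
proof (intro conjI allI impI)
  show "is_rep C111 (*s) (natural_rep :: rat^3^3 \<Rightarrow> _)" by (rule is_rep_natural)
  show "\<exists>v::rat^3. v \<noteq> 0" by (rule exI[of _ "axis 1 1"]) simp
  fix W :: "(rat^3) set"
  assume W: "vec.subspace W \<and> (\<forall>x\<in>C111. \<forall>w\<in>W. natural_rep x w \<in> W)"
  then show "W = {0} \<or> W = UNIV"
    by (intro shift_invariant_subspace[of W 1]) (auto simp: natural_cyc_mat[symmetric])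
qed

lemma irreducible_cotranspose: "irreducible_rep C111 (*s) cotranspose_rep"
  unfolding irreducible_rep_def
proof (intro conjI allI impI)
  show "is_rep C111 (*s) (cotranspose_rep :: rat^3^3 \<Rightarrow> _)" by (rule is_rep_cotranspose)
  show "\<exists>v::rat^3. v \<noteq> 0" by (rule exI[of _ "axis 1 1"]) simp
  fix W :: "(rat^3) set"
  assume W: "vec.subspace W \<and> (\<forall>x\<in>C111. \<forall>w\<in>W. cotranspose_rep x w \<in> W)"
  have "w $ k *s axis (k + 2) 1 \<in> W" if "w \<in> W" for k w
  proof -
    \<comment> \<open>The generator \<open>k + 2\<close> reads coordinate
      \<open>k + 2 + 1 = k\<close> and writes position \<open>k + 2\<close>.\<close>
    have "cotranspose_rep (cyc_mat (k + 2)) w \<in> W"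
      using W that by blast
    then have "- (w $ k *s axis (k + 2) 1) \<in> W"
      unfolding cotranspose_cyc_mat by (simp add: add.assoc)
    then show ?thesis
      using W vec.subspace_neg by fastforce
  qed
  then show "W = {0} \<or> W = UNIV"
    using W by (intro shift_invariant_subspace[of W 2]) auto
qed

lemma irreducible_trivial: "irreducible_rep C111 (*) trivial_rep"
  unfolding irreducible_rep_def
proof (intro conjI allI impI)
  show "is_rep C111 (*) trivial_rep" by (rule is_rep_trivial)
  show "\<exists>v::rat. v \<noteq> 0" by (rule exI[of _ 1]) simp
  fix W :: "rat set"
  assume W: "vector_space_over_itself.subspace W \<and> (\<forall>x\<in>C111. \<forall>w\<in>W. trivial_rep x w \<in> W)"
  show "W = {0} \<or> W = UNIV"
  proof (cases "W \<subseteq> {0}")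
    case True
    then show ?thesis using W vector_space_over_itself.subspace_0 by blast
  next
    case False
    then obtain w where "w \<in> W" "w \<noteq> 0" by auto
    then have "(q / w) * w \<in> W" for q
      using W vector_space_over_itself.subspace_scale by blast
    then have "q \<in> W" for q
      using \<open>w \<noteq> 0\<close> by simp
    then show ?thesis by auto
  qed
qed

section \<open>Separating the representations\<close>

lemma natural_not_isomorphic_cotranspose: "\<not> rep_isomorphic C111 (*s) natural_rep (*s) cotranspose_rep"
proof
  assume "rep_isomorphic C111 (*s) natural_rep (*s) cotranspose_rep"
  then obtain T where "bij T" and T: "\<And>x v. x \<in> C111 \<Longrightarrow> T (natural_rep x v) = cotranspose_rep x (T v)"
    and lin: "Vector_Spaces.linear (*s) (*s) T"
    unfolding rep_isomorphic_def by blast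
  \<comment> \<open>The product E(3, 2) E(2, 1) sends the first axis vector to the third, whereas
    the corresponding product E(2, 3) E(1, 2) of the transposes is zero.\<close>
  define v where "v = natural_rep (cyc_mat 2) (natural_rep (cyc_mat 1) (axis 1 1))"
  have "T v = cotranspose_rep (cyc_mat 2) (cotranspose_rep (cyc_mat 1) (T (axis 1 1)))"
    by (simp only: v_def T cyc_mat_in_C111)
  also have "\<dots> = 0"
    by (simp only: cotranspose_cyc_mat) (simp add: axis_def vec_eq_iff)
  also have "0 = T 0"
    using lin unfolding Vector_Spaces.linear_iff by (metis add_cancel_right_left)
  finally have "v = 0"
    using \<open>bij T\<close> by (meson bij_is_inj injD)
  then have "v $ 3 = 0" by simp
  then show False
    unfolding v_def natural_cyc_mat by (simp add: axis_def)
qed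

lemma trivial_not_isomorphic_3:
  fixes \<sigma> :: "rat^3^3 \<Rightarrow> rat^3 \<Rightarrow> rat^3"
  shows "\<not> rep_isomorphic J (*s) \<sigma> (*) trivial_rep"
proof
  assume "rep_isomorphic J (*s) \<sigma> (*) trivial_rep"
  then obtain T :: "rat^3 \<Rightarrow> rat" where "bij T" and lin: "Vector_Spaces.linear (*s) (*) T"
    unfolding rep_isomorphic_def by blast
  interpret T: Vector_Spaces.linear "(*s)" "(*)" T by fact
  have inj: "v = 0" if "T v = 0" for v
    using that \<open>bij T\<close> T.inj_iff_eq_0 bij_is_inj by blast
  \<comment> \<open>Two vectors with scalar images are always dependent after applying
    \<open>T\<close>; this combination is the explicit kernel element, and its first coordinate is
    the image of the second axis vector.\<close>
  have "T (T (axis (2::3) 1) *s axis 1 1 - T (axis 1 1) *s axis (2::3) 1) = 0"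
    by (simp add: T.diff T.scale)
  then have "T (axis (2::3) 1) *s axis 1 1 - T (axis 1 1) *s axis (2::3) 1 = 0"
    by (rule inj)
  then have "(T (axis (2::3) 1) *s axis 1 1 - T (axis 1 1) *s axis (2::3) 1) $ 1 = 0"
    by simp
  then have "T (axis (2::3) 1) = 0"
    by (simp add: axis_def)
  then show False
    using inj[of "axis (2::3) 1"] by simp
qed

section \<open>Classification of the irreducible representations\<close>

lemma additive_endo_ring_simps:
  "f \<otimes>\<^bsub>additive_endo_ring\<^esub> g = f \<circ> g" "(f \<oplus>\<^bsub>additive_endo_ring\<^esub> g) v = f v + g v"
  "\<zero>\<^bsub>additive_endo_ring\<^esub> = (\<lambda>_. 0)"
  "f \<in> carrier additive_endo_ring \<longleftrightarrow> (\<forall>x y. f (x + y) = f x + f y)"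
  by (simp_all add: additive_endo_ring_def)

text \<open>The ring negative is given by a description, so its values are read off from the law of
  the additive inverse.\<close>

lemma additive_endo_ring_minus:
  assumes "f \<in> carrier additive_endo_ring"
  shows "(\<ominus>\<^bsub>additive_endo_ring\<^esub> f) v = - f v"
proof -
  interpret ring "additive_endo_ring :: ('a \<Rightarrow> 'a) ring" by (rule ring_additive_endo_ring)
  have "(\<ominus>\<^bsub>additive_endo_ring\<^esub> f \<oplus>\<^bsub>additive_endo_ring\<^esub> f) v = 0"
    using assms by (simp add: l_neg) (simp add: additive_endo_ring_simps)
  then show ?thesis
    by (simp add: additive_endo_ring_simps eq_neg_iff_add_eq_0)
qed

lemma rep_cyclic_tetrad:
  assumes "is_rep C111 s \<rho>"
  shows "cyclic_tetrad additive_endo_ring (\<lambda>k. \<rho> (cyc_mat k))"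
proof (rule cyclic_tetradI[OF ring_additive_endo_ring])
  show "\<rho> x \<in> carrier additive_endo_ring" if "x \<in> C111" for x
    using assms that by (simp add: is_rep_def Vector_Spaces.linear_iff additive_endo_ring_simps)
  have "0 \<in> C111" by (simp add: mem_C111_iff)
  then have "\<rho> (0 + 0) v = \<rho> 0 v + \<rho> 0 v" for v
    using assms unfolding is_rep_def by blast
  then show "\<rho> 0 = \<zero>\<^bsub>additive_endo_ring\<^esub>"
    by (simp add: additive_endo_ring_simps fun_eq_iff)
qed (use assms in \<open>simp add: is_rep_def additive_endo_ring_simps fun_eq_iff\<close>)

lemma irreducible_rep_C111_classification:
  fixes s :: "rat \<Rightarrow> 'v \<Rightarrow> 'v::ab_group_add"
  assumes irr: "irreducible_rep C111 s \<rho>"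
  shows "rep_isomorphic C111 s \<rho> (*) trivial_rep \<or>
    rep_isomorphic C111 s \<rho> (*s) natural_rep \<or>
    rep_isomorphic C111 s \<rho> (*s) cotranspose_rep"
proof -
  have rep: "is_rep C111 s \<rho>" using irr by (simp add: irreducible_rep_def)
  interpret V: vector_space s using rep by (simp add: is_rep_def)
  interpret ring "additive_endo_ring :: ('v \<Rightarrow> 'v) ring" by (rule ring_additive_endo_ring)
  interpret cyclic_tetrad "additive_endo_ring :: ('v \<Rightarrow> 'v) ring" "\<lambda>k. \<rho> (cyc_mat k)"
    by (rule rep_cyclic_tetrad[OF rep])
  define r where "r = (\<lambda>k. \<rho> (cyc_mat k))"
  define E where "E = cyc_unit additive_endo_ring r"
  define F where "F = cocyc_unit"
  have lin: "Vector_Spaces.linear s s (r k)" for k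
    using rep by (simp add: is_rep_def r_def)
  have r_comb: "r k (\<Sum>i\<in>UNIV. s (u i) (x i)) = (\<Sum>i\<in>UNIV. s (u i) (r k (x i)))" for k and u :: "3 \<Rightarrow> rat" and x
  proof -
    interpret Vector_Spaces.linear s s "r k" by (rule lin)
    show ?thesis by (simp only: sum scale)
  qed
  have rE: "r k (E i j v) = (if i = k then E (k + 1) j v else 0)" for k i j v
    using fun_cong[OF gen_mult_cyc_unit[of k i j], of v]
    by (simp add: additive_endo_ring_simps r_def E_def split: if_splits)
  have rF: "r k (F i j v) = (if i = k + 1 then - F k j v else 0)" for k i j v
    using fun_cong[OF gen_mult_cocyc_unit[of k i j], of v]
    by (simp add: additive_endo_ring_simps(1,3) additive_endo_ring_minus r_def F_def split: if_splits)
  have r_decomp: "r k v = E (k + 1) k v - F k (k + 1) v" for k v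
    using fun_cong[OF gen_decomp[of k], of v]
    by (simp add: a_minus_def additive_endo_ring_simps(2) additive_endo_ring_minus r_def E_def F_def)
  have comb_linear: "Vector_Spaces.linear (*s) s (\<lambda>u :: rat^3. \<Sum>i\<in>UNIV. s (u $ i) (x i))" for x
    by (simp add: Vector_Spaces.linear_iff vec.vector_space_axioms V.vector_space_axioms
        V.scale_left_distrib sum.distrib V.scale_sum_right)
  have comb_axis: "(\<Sum>i\<in>UNIV. s ((q *s axis k 1 :: rat^3) $ i) (x i)) = s q (x k)" for x k q
    by (simp add: axis_def if_distrib[of "\<lambda>a. s a _"] if_distrib[of "\<lambda>a. _ * a"] cong: if_cong)
  consider i j v where "E i j v \<noteq> 0" | i j v where "F i j v \<noteq> 0"
    | "\<And>i j v. E i j v = 0" "\<And>i j v. F i j v = 0"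
    by blast
  then show ?thesis
  proof cases
    case (1 i j v)
    \<comment> \<open>Column \<open>j\<close> and vector \<open>v\<close> stay fixed while the axis
      vectors go to \<open>E i j v\<close> with varying row; \<open>rE\<close> is then the
      intertwining property.\<close>
    define T where "T u = (\<Sum>i\<in>UNIV. s (u $ i) (E i j v))" for u :: "rat^3"
    have lin: "Vector_Spaces.linear (*s) s T"
      unfolding T_def by (rule comb_linear)
    have "T (natural_rep (cyc_mat k) u) = \<rho> (cyc_mat k) (T u)" for k u
      unfolding natural_cyc_mat T_def comb_axis r_def[symmetric, THEN fun_cong] r_comb rE
      by (simp add: if_distrib[of "s _"] cong: if_cong)
    then have comm: "T (natural_rep x u) = \<rho> x (T u)" if "x \<in> C111" for x u
      using rep_C111_intertwine[OF is_rep_natural rep lin _ that, of u] by blast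
    have nonzero: "T (1 *s axis i 1) \<noteq> 0"
      unfolding T_def comb_axis using 1 by simp
    have "rep_isomorphic C111 (*s) natural_rep s \<rho>"
      by (rule schur_isomorphic[OF irreducible_natural irr lin comm nonzero])
    then show ?thesis using rep_isomorphic_sym by blast
  next
    case (2 i j v)
    define T where "T u = (\<Sum>i\<in>UNIV. s (u $ i) (F i j v))" for u :: "rat^3"
    have lin: "Vector_Spaces.linear (*s) s T"
      unfolding T_def by (rule comb_linear)
    have "T (cotranspose_rep (cyc_mat k) u) = \<rho> (cyc_mat k) (T u)" for k u
    proof -
      \<comment> \<open>The sign is moved into the scalar so that \<open>comb_axis\<close>
        applies.\<close>
      have "cotranspose_rep (cyc_mat k) u = (- (u $ (k + 1))) *s axis k 1"
        by (simp add: cotranspose_cyc_mat)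
      then show ?thesis
        unfolding T_def r_def[symmetric, THEN fun_cong] r_comb rF
        by (simp only: comb_axis) (simp add: if_distrib[of "s _"] cong: if_cong)
    qed
    then have comm: "T (cotranspose_rep x u) = \<rho> x (T u)" if "x \<in> C111" for x u
      using rep_C111_intertwine[OF is_rep_cotranspose rep lin _ that, of u] by blast
    have nonzero: "T (1 *s axis i 1) \<noteq> 0"
      unfolding T_def comb_axis using 2 by simp
    have "rep_isomorphic C111 (*s) cotranspose_rep s \<rho>"
      by (rule schur_isomorphic[OF irreducible_cotranspose irr lin comm nonzero])
    then show ?thesis using rep_isomorphic_sym by blast
  next
    case 3
    have zero: "\<rho> x v = 0" if "x \<in> C111" for x v
      using rep_C111_decomp[OF rep that, of v] r_decomp 3 by (simp add: r_def)
    obtain v :: 'v where "v \<noteq> 0" using irr by (auto simp: irreducible_rep_def)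
    \<comment> \<open>Both actions are zero here, so the line through any nonzero \<open>v\<close>
      already gives a nonzero intertwiner.\<close>
    have lin: "Vector_Spaces.linear (*) s (\<lambda>q. s q v)"
      by (simp add: Vector_Spaces.linear_iff vector_space_over_itself.vector_space_axioms
          V.vector_space_axioms V.scale_left_distrib)
    have "rep_isomorphic C111 (*) trivial_rep s \<rho>"
      using schur_isomorphic[OF irreducible_trivial irr lin, of 1] \<open>v \<noteq> 0\<close>
      by (simp add: zero trivial_rep_def)
    then show ?thesis using rep_isomorphic_sym by blast
  qed
qed

section \<open>Evaluation of the free algebra\<close>

text \<open>Scaling is rewritten as multiplication by a constant polynomial, which makes statements
  about scalars statements about the ring product.\<close>

lemma free_alg_simps [simp]:
  "carrier (free_alg B) = {p. \<forall>w\<in>Poly_Mapping.keys p. set (letters w) \<subseteq> B}"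
  "x \<otimes>\<^bsub>free_alg B\<^esub> y = x * y" "\<one>\<^bsub>free_alg B\<^esub> = 1"
  "x \<oplus>\<^bsub>free_alg B\<^esub> y = x + y" "\<zero>\<^bsub>free_alg B\<^esub> = 0"
  "q \<odot>\<^bsub>free_alg B\<^esub> x = Poly_Mapping.single 0 q * x"
  by (simp_all add: free_alg_def mult_map_scale_conv_mult)

lemma ring_free_alg: "ring (free_alg B)"
proof (intro ringI abelian_groupI monoidI)
  fix x y
  assume xy: "x \<in> carrier (free_alg B)" "y \<in> carrier (free_alg B)"
  then show "x \<oplus>\<^bsub>free_alg B\<^esub> y \<in> carrier (free_alg B)"
    using Poly_Mapping.keys_add[of x y] by auto
  from xy show "x \<otimes>\<^bsub>free_alg B\<^esub> y \<in> carrier (free_alg B)"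
    using Poly_Mapping.keys_mult[of x y] by (fastforce simp: plus_word_def)
next
  fix x
  assume "x \<in> carrier (free_alg B)"
  then show "\<exists>y\<in>carrier (free_alg B). y \<oplus>\<^bsub>free_alg B\<^esub> x = \<zero>\<^bsub>free_alg B\<^esub>"
    by (intro bexI[of _ "- x"]) (auto simp: in_keys_iff)
qed (simp_all add: distrib_left distrib_right mult.assoc add.assoc add.commute zero_word_def)

lemma free_alg_minus:
  assumes "x \<in> carrier (free_alg B)" "y \<in> carrier (free_alg B)"
  shows "\<ominus>\<^bsub>free_alg B\<^esub> x = - x" and "y \<ominus>\<^bsub>free_alg B\<^esub> x = y - x"
proof -
  interpret ring "free_alg B" by (rule ring_free_alg)
  show *: "\<ominus>\<^bsub>free_alg B\<^esub> x = - x"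
    using l_neg[OF assms(1)] by (simp only: free_alg_simps eq_neg_iff_add_eq_0)
  show "y \<ominus>\<^bsub>free_alg B\<^esub> x = y - x"
    by (simp add: a_minus_def *)
qed

lemma gen_in_free_alg: "b \<in> B \<Longrightarrow> gen b \<in> carrier (free_alg B)"
  by (simp add: gen_def)

lemma const_in_free_alg [simp, intro]: "Poly_Mapping.single 0 q \<in> carrier (free_alg B)"
  by (auto simp: zero_word_def)

lemma free_alg_induct [consumes 1, case_names zero monomial add]:
  assumes "p \<in> carrier (free_alg B)" "P 0"
    and "\<And>l c. set l \<subseteq> B \<Longrightarrow> P (Poly_Mapping.single (Word l) c)"
    and "\<And>p q. P p \<Longrightarrow> P q \<Longrightarrow> P (p + q)"
  shows "P p"
proof -
  have *: "P (\<Sum>w\<in>W. Poly_Mapping.single w (Poly_Mapping.lookup p w))"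
    if "finite W" "W \<subseteq> Poly_Mapping.keys p" for W
    using that
  proof induction
    case (insert w W)
    then have "P (Poly_Mapping.single w (Poly_Mapping.lookup p w))"
      using assms(1) assms(3)[of "letters w"] by auto
    then show ?case
      using insert assms(4) by simp
  qed (simp add: assms(2))
  have "(\<Sum>w\<in>Poly_Mapping.keys p. Poly_Mapping.single w (Poly_Mapping.lookup p w)) = p"
    by (rule poly_mapping_eqI)
      (auto simp: lookup_sum lookup_single when_def sum.delta in_keys_iff)
  then show ?thesis using *[OF finite_keys order_refl] by simp
qed

lemma poly_mapping_word_induct [case_names zero monomial add]:
  fixes p :: "'a word \<Rightarrow>\<^sub>0 rat"
  assumes "P 0" "\<And>l c. P (Poly_Mapping.single (Word l) c)"
    and "\<And>p q. P p \<Longrightarrow> P q \<Longrightarrow> P (p + q)"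
  shows "P p"
  using free_alg_induct[of p UNIV P] assms by simp

abbreviation const :: "rat \<Rightarrow> 'a word \<Rightarrow>\<^sub>0 rat" where
  "const \<equiv> Poly_Mapping.single 0"

text \<open>Constants are supported on the empty word, the unit for concatenation, hence are
  central.\<close>

lemma const_commute: "p * const q = const q * (p :: 'a word \<Rightarrow>\<^sub>0 rat)"
  by (induction p rule: poly_mapping_word_induct) (simp_all add: mult_single algebra_simps)

lemma const_left_commute: "p * (const q * r) = const q * (p * (r :: 'a word \<Rightarrow>\<^sub>0 rat))"
  by (metis const_commute mult.assoc)

interpretation polyQ: vector_space "\<lambda>q (p :: 'a word \<Rightarrow>\<^sub>0 rat). const q * p"
  by unfold_locales (simp_all add: single_add distrib_left distrib_right mult_single flip: mult.assoc)

locale rat_algebra = vector_space s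
  for s :: "rat \<Rightarrow> 'c \<Rightarrow> 'c::ab_group_add" +
  fixes m :: "'c \<Rightarrow> 'c \<Rightarrow> 'c" and u :: 'c
  assumes m_assoc: "m (m x y) z = m x (m y z)"
    and m_units: "m u x = x" "m x u = x"
    and m_add: "m (x + y) z = m x z + m y z" "m x (y + z) = m x y + m x z"
    and m_scale: "m (s q x) y = s q (m x y)" "m x (s q y) = s q (m x y)"
begin

text \<open>The algebra homomorphism extending \<open>\<rho>\<close> that the universal property of
  the free algebra provides; the empty word evaluates to the unit \<open>u\<close>.\<close>

definition eval :: "('b \<Rightarrow> 'c) \<Rightarrow> ('b word \<Rightarrow>\<^sub>0 rat) \<Rightarrow> 'c" where
  "eval \<rho> p = (\<Sum>w\<in>Poly_Mapping.keys p. s (Poly_Mapping.lookup p w) (foldr (\<lambda>b. m (\<rho> b)) (letters w) u))"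

text \<open>Words outside the support contribute zero; polynomials with different supports can
  therefore be summed over one common index set, as \<open>eval_add\<close> requires.\<close>

lemma eval_superset:
  assumes "finite W" "Poly_Mapping.keys p \<subseteq> W"
  shows "eval \<rho> p = (\<Sum>w\<in>W. s (Poly_Mapping.lookup p w) (foldr (\<lambda>b. m (\<rho> b)) (letters w) u))"
  unfolding eval_def using assms by (intro sum.mono_neutral_left) (auto simp: in_keys_iff)

lemma eval_add: "eval \<rho> (p + q) = eval \<rho> p + eval \<rho> q"
proof -
  have "finite (Poly_Mapping.keys p \<union> Poly_Mapping.keys q)" by simp
  note eval_superset[OF this]
  then show ?thesis
    using Poly_Mapping.keys_add[of p q] by (simp add: lookup_add scale_left_distrib sum.distrib)
qed

lemma eval_0 [simp]: "eval \<rho> 0 = 0"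
  by (simp add: eval_def)

lemma eval_minus: "eval \<rho> (- p) = - eval \<rho> p"
  using eval_add[of \<rho> p "- p"] by (simp add: eq_neg_iff_add_eq_0 add.commute)

lemma eval_diff: "eval \<rho> (p - q) = eval \<rho> p - eval \<rho> q"
  using eval_add[of \<rho> p "- q"] by (simp add: eval_minus)

lemma eval_sum: "eval \<rho> (sum f A) = (\<Sum>x\<in>A. eval \<rho> (f x))"
  by (induction A rule: infinite_finite_induct) (simp_all add: eval_add)

lemma eval_monomial: "eval \<rho> (Poly_Mapping.single (Word l) c) = s c (foldr (\<lambda>b. m (\<rho> b)) l u)"
  by (cases "c = 0") (simp_all add: eval_def)

lemma foldr_m_append: "foldr (\<lambda>b. m (\<rho> b)) k (foldr (\<lambda>b. m (\<rho> b)) l u) = m (foldr (\<lambda>b. m (\<rho> b)) k u) (foldr (\<lambda>b. m (\<rho> b)) l u)"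
  by (induction k) (simp_all add: m_units m_assoc)

lemma m_zero: "m 0 x = 0" "m x 0 = 0"
  using m_add(1)[of 0 0 x] m_add(2)[of x 0 0] by simp_all

lemma eval_mult: "eval \<rho> (p * q) = m (eval \<rho> p) (eval \<rho> q)"
proof (induction p rule: poly_mapping_word_induct)
  case (monomial k c)
  show ?case
    by (induction q rule: poly_mapping_word_induct)
      (simp_all add: m_zero mult_single plus_word_def eval_monomial foldr_m_append m_scale
        algebra_simps eval_add m_add)
qed (simp_all add: m_zero algebra_simps eval_add m_add)

lemma eval_const: "eval \<rho> (const q) = s q u"
  using eval_monomial[of \<rho> "[]" q] by (simp add: zero_word_def)

lemma eval_1: "eval \<rho> 1 = u"
  using eval_const[of \<rho> 1] by simp

lemma eval_gen: "eval \<rho> (gen b) = \<rho> b"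
  by (simp add: gen_def eval_monomial m_units)

end

lemma cyc_unit_hom:
  assumes "h \<in> ring_hom R S" "\<And>k. g k \<in> carrier R" "ring R"
  shows "h (cyc_unit R g i j) = cyc_unit S (\<lambda>k. h (g k)) i j"
proof -
  interpret ring R by fact
  show ?thesis using assms by (simp add: cyc_unit_def ring_hom_mult)
qed

section \<open>The universal envelope\<close>

type_synonym target = "rat \<times> (rat^3^3) \<times> (rat^3^3)"

abbreviation target_alg :: "(rat, target) module" where
  "target_alg \<equiv> alg_sum rat_alg (alg_sum mat_alg mat_alg)"

fun target_scale :: "rat \<Rightarrow> target \<Rightarrow> target" where
  "target_scale q (x, A, C) = (q * x, mat_scale q A, mat_scale q C)"

fun target_mult :: "target \<Rightarrow> target \<Rightarrow> target" where
  "target_mult (x, A, C) (y, A', C') = (x * y, A ** A', C ** C')"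

lemma alg_sum_simps:
  "carrier (alg_sum A A') = carrier A \<times> carrier A'"
  "(x, x') \<otimes>\<^bsub>alg_sum A A'\<^esub> (y, y') = (x \<otimes>\<^bsub>A\<^esub> y, x' \<otimes>\<^bsub>A'\<^esub> y')"
  "\<one>\<^bsub>alg_sum A A'\<^esub> = (\<one>\<^bsub>A\<^esub>, \<one>\<^bsub>A'\<^esub>)"
  "(x, x') \<oplus>\<^bsub>alg_sum A A'\<^esub> (y, y') = (x \<oplus>\<^bsub>A\<^esub> y, x' \<oplus>\<^bsub>A'\<^esub> y')"
  "\<zero>\<^bsub>alg_sum A A'\<^esub> = (\<zero>\<^bsub>A\<^esub>, \<zero>\<^bsub>A'\<^esub>)"
  "q \<odot>\<^bsub>alg_sum A A'\<^esub> (x, x') = (q \<odot>\<^bsub>A\<^esub> x, q \<odot>\<^bsub>A'\<^esub> x')"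
  unfolding alg_sum_def by (simp_all add: ring.defs module.defs RDirProd_def DirProd_def monoid.defs)

lemma base_alg_simps:
  "carrier rat_alg = UNIV" "carrier mat_alg = UNIV"
  "x \<otimes>\<^bsub>rat_alg\<^esub> y = x * y" "A \<otimes>\<^bsub>mat_alg\<^esub> C = A ** C"
  "\<one>\<^bsub>rat_alg\<^esub> = 1" "\<one>\<^bsub>mat_alg\<^esub> = mat 1"
  "x \<oplus>\<^bsub>rat_alg\<^esub> y = x + y" "A \<oplus>\<^bsub>mat_alg\<^esub> C = A + C"
  "\<zero>\<^bsub>rat_alg\<^esub> = 0" "\<zero>\<^bsub>mat_alg\<^esub> = 0"
  "q \<odot>\<^bsub>rat_alg\<^esub> x = q * x" "q \<odot>\<^bsub>mat_alg\<^esub> A = mat_scale q A"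
  by (simp_all add: rat_alg_def mat_alg_def)

lemma target_alg_simps:
  "carrier target_alg = UNIV" "x \<otimes>\<^bsub>target_alg\<^esub> y = target_mult x y"
  "\<one>\<^bsub>target_alg\<^esub> = (1, mat 1, mat 1)" "x \<oplus>\<^bsub>target_alg\<^esub> y = x + y"
  "\<zero>\<^bsub>target_alg\<^esub> = 0" "q \<odot>\<^bsub>target_alg\<^esub> x = target_scale q x"
  by (cases x rule: prod_cases3, cases y rule: prod_cases3,
      simp only: alg_sum_simps base_alg_simps zero_prod_def target_mult.simps target_scale.simps
        add_Pair UNIV_Times_UNIV)+

lemma mat_scale_mult: "mat_scale q A ** C = mat_scale q (A ** C)" "A ** mat_scale q C = mat_scale q (A ** C)"
  by (simp_all add: mat_scale_def vec_eq_iff matrix_matrix_mult_def sum_distrib_left mult.assoc mult.left_commute)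

lemma matrix_add_mult: "(A + C) ** D = A ** D + C ** D" for A C :: "rat^'n^'m"
  by (simp add: vec_eq_iff matrix_matrix_mult_def sum.distrib distrib_right)

interpretation T: rat_algebra target_scale target_mult "(1, mat 1, mat 1)"
  by unfold_locales
    (simp_all add: split_paired_all matQ.scale_left_distrib matQ.scale_right_distrib mat_scale_mult
      matrix_add_ldistrib matrix_add_mult distrib_left distrib_right matrix_mul_assoc)

lemma ring_target_alg: "ring target_alg"
proof (intro ringI abelian_groupI monoidI)
  fix x
  show "\<exists>y\<in>carrier target_alg. y \<oplus>\<^bsub>target_alg\<^esub> x = \<zero>\<^bsub>target_alg\<^esub>"
    by (intro bexI[of _ "- x"]) (simp_all add: target_alg_simps)
qed (simp_all add: target_alg_simps T.m_assoc T.m_units T.m_add add_ac)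

text \<open>The components extend the trivial representation, the natural one and its contragredient
  to the free algebra.\<close>

definition env_map :: "((rat^3^3) word \<Rightarrow>\<^sub>0 rat) \<Rightarrow> target" where
  "env_map = T.eval (\<lambda>b. (0, b, cotranspose b))"

lemma env_map_hom: "ring_hom_ring (free_alg B) target_alg env_map"
  by (rule ring_hom_ringI[OF ring_free_alg ring_target_alg])
    (simp_all add: target_alg_simps env_map_def T.eval_add T.eval_mult T.eval_1)

section \<open>The free algebra on a basis and the ideal of relators\<close>

locale C111_basis =
  fixes B :: "(rat^3^3) set"
  assumes independent: "matQ.independent B" and span: "matQ.span B = C111"
begin

abbreviation F :: "(rat, (rat^3^3) word \<Rightarrow>\<^sub>0 rat) module" where "F \<equiv> free_alg B"
abbreviation I :: "((rat^3^3) word \<Rightarrow>\<^sub>0 rat) set" where "I \<equiv> Idl\<^bsub>F\<^esub> (env_relators B)"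
text \<open>The basis is arbitrary, so the matrices \<open>cyc_mat k\<close> enter the free algebra
  through \<open>L\<close>, as linear combinations of generators.\<close>

abbreviation L :: "rat^3^3 \<Rightarrow> (rat^3^3) word \<Rightarrow>\<^sub>0 rat" where "L \<equiv> lin_gen B"

sublocale F: ring F by (rule ring_free_alg)

text \<open>Finiteness keeps the sum over \<open>B\<close> in \<open>lin_gen\<close> meaningful,
  since a sum over an infinite set is 0 by convention.\<close>

lemma finite_basis [simp]: "finite B"
proof -
  have "C111 \<subseteq> matQ.span (range cyc_mat)"
    using C111_decomp by (metis (no_types, lifting) matQ.span_base matQ.span_scale matQ.span_sum range_eqI subsetI)
  then have "B \<subseteq> matQ.span (range cyc_mat)"
    using matQ.span_superset[of B] span by blast
  then show ?thesis
    using matQ.independent_span_bound[OF _ independent, of "range cyc_mat"] by simp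
qed

lemma basis_subset: "b \<in> B \<Longrightarrow> b \<in> C111"
  using matQ.span_base[of b B] span by simp

lemma F_add: "\<lbrakk>p \<in> carrier F; q \<in> carrier F\<rbrakk> \<Longrightarrow> p + q \<in> carrier F"
  and F_mult: "\<lbrakk>p \<in> carrier F; q \<in> carrier F\<rbrakk> \<Longrightarrow> p * q \<in> carrier F"
  and F_diff: "\<lbrakk>p \<in> carrier F; q \<in> carrier F\<rbrakk> \<Longrightarrow> p - q \<in> carrier F"
  and F_zero: "0 \<in> carrier F" and F_one: "1 \<in> carrier F"
  using F.a_closed[of p q] F.m_closed[of p q] F.minus_closed[of p q] free_alg_minus(2)[of q B p]
    F.zero_closed F.one_closed
  by (simp_all only: free_alg_simps)

lemma F_sum: "(\<And>x. x \<in> A \<Longrightarrow> f x \<in> carrier F) \<Longrightarrow> sum f A \<in> carrier F"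
  by (induction A rule: infinite_finite_induct) (auto simp del: free_alg_simps(1) intro: F_add F_zero)

lemma L_def: "L x = (\<Sum>b\<in>B. const (matQ.representation B x b) * gen b)"
  by (simp add: lin_gen_def)

lemma L_closed [simp]: "L x \<in> carrier F"
  unfolding L_def by (intro F_sum F_mult const_in_free_alg gen_in_free_alg)

lemma L_add: "\<lbrakk>x \<in> C111; y \<in> C111\<rbrakk> \<Longrightarrow> L (x + y) = L x + L y"
  unfolding L_def
  by (simp add: matQ.representation_add[OF independent] span single_add distrib_right sum.distrib)

lemma L_scale: "x \<in> C111 \<Longrightarrow> L (mat_scale q x) = const q * L x"
  unfolding L_def
  by (simp add: matQ.representation_scale[OF independent] span sum_distrib_left mult_single flip: mult.assoc)

lemma L_basis: "b \<in> B \<Longrightarrow> L b = gen b"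
  unfolding L_def
  by (simp add: matQ.representation_basis[OF independent] if_distrib[of const] if_distrib[of "\<lambda>x. x * _"] sum.delta cong: if_cong)

lemma L_zero: "L 0 = 0"
  by (simp add: L_def matQ.representation_zero)

lemma C111_scale: "x \<in> C111 \<Longrightarrow> mat_scale q x \<in> C111"
  by (simp add: mem_C111_iff mat_scale_def)

lemma env_map_L: "x \<in> C111 \<Longrightarrow> env_map (L x) = (0, x, cotranspose x)"
proof -
  assume "x \<in> C111"
  have "env_map (L x) = (\<Sum>b\<in>B. target_scale (matQ.representation B x b) (0, b, cotranspose b))"
    by (simp add: env_map_def L_def T.eval_sum T.eval_mult T.eval_const T.eval_gen T.m_scale T.m_units
        del: target_scale.simps)
  also have "\<dots> = (0, \<Sum>b\<in>B. mat_scale (matQ.representation B x b) b,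
      \<Sum>b\<in>B. cotranspose (mat_scale (matQ.representation B x b) b))"
    by (simp add: sum_prod cotranspose_scale)
  also have "(\<Sum>b\<in>B. cotranspose (mat_scale (matQ.representation B x b) b)) =
      cotranspose (\<Sum>b\<in>B. mat_scale (matQ.representation B x b) b)"
    by (simp add: cotranspose_def transpose_def vec_eq_iff sum_negf)
  also have "(\<Sum>b\<in>B. mat_scale (matQ.representation B x b) b) = x"
    using \<open>x \<in> C111\<close> by (intro matQ.sum_representation_eq[OF independent]) (simp_all add: span)
  finally show ?thesis .
qed

lemma antitetrad_C111: "\<lbrakk>a \<in> C111; b \<in> C111; c \<in> C111; d \<in> C111\<rbrakk> \<Longrightarrow> antitetrad a b c d \<in> C111"
  using antitetrad_closed_subspace_C111 by (simp add: antitetrad_closed_subspace_def)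

lemma relators_in_F: "env_relators B \<subseteq> carrier F"
proof
  fix r assume "r \<in> env_relators B"
  then show "r \<in> carrier F"
    unfolding env_relators_def
    by (auto simp del: free_alg_simps(1) intro!: F_diff F_mult L_closed gen_in_free_alg)
qed

sublocale I: ideal I F
  by (rule F.genideal_ideal[OF relators_in_F])

lemma I_subset: "p \<in> I \<Longrightarrow> p \<in> carrier F"
  by (rule I.a_Hcarr)

lemma I_add: "\<lbrakk>p \<in> I; q \<in> I\<rbrakk> \<Longrightarrow> p + q \<in> I"
  using I.a_closed[of p q] by simp

lemma I_left: "\<lbrakk>p \<in> I; q \<in> carrier F\<rbrakk> \<Longrightarrow> q * p \<in> I"
  using I.I_l_closed[of p q] by (simp only: free_alg_simps)

lemma I_zero: "0 \<in> I"
  using I.zero_closed by simp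

lemma coset_eq_iff: "\<lbrakk>p \<in> carrier F; q \<in> carrier F\<rbrakk> \<Longrightarrow> I +>\<^bsub>F\<^esub> p = I +>\<^bsub>F\<^esub> q \<longleftrightarrow> p - q \<in> I"
  using F.quotient_eq_iff_same_a_r_cos[OF I.ideal_axioms, of p q] free_alg_minus(2)[of q B p] by simp

text \<open>Passes from basis elements to all of \<open>C111\<close> in one argument. Linearity is
  asked for on \<open>C111\<close> only, because coordinates outside the span of \<open>B\<close>
  default to 0.\<close>

lemma span_induct_linear:
  assumes "x \<in> C111" "\<And>b. b \<in> B \<Longrightarrow> f b \<in> I"
    and "\<And>x y. \<lbrakk>x \<in> C111; y \<in> C111\<rbrakk> \<Longrightarrow> f (x + y) = f x + f y"
    and "\<And>q x. x \<in> C111 \<Longrightarrow> f (mat_scale q x) = const q * f x"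
  shows "f x \<in> I"
proof -
  have 0: "0 \<in> C111" by (simp add: mem_C111_iff)
  have "x \<in> matQ.span B" using assms(1) span by simp
  then have "x \<in> C111 \<and> f x \<in> I"
  proof (induction rule: matQ.span_induct_alt)
    case base
    show ?case using assms(4)[OF 0, of 0] 0 I_zero by simp
  next
    case (step c x y)
    then have "x \<in> C111" using basis_subset by blast
    then have "mat_scale c x \<in> C111" by (rule C111_scale)
    moreover have "const c * f x \<in> I"
      by (intro I_left assms(2) step const_in_free_alg)
    ultimately show ?case
      using step assms(3,4) \<open>x \<in> C111\<close> by (auto intro: I_add C111_add)
  qed
  then show ?thesis by simp
qed

section \<open>Relators with arbitrary arguments\<close>

lemma antitetrad_add:
  "antitetrad (x + y) b c d = antitetrad x b c d + antitetrad y b c d"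
  "antitetrad a (x + y) c d = antitetrad a x c d + antitetrad a y c d"
  "antitetrad a b (x + y) d = antitetrad a b x d + antitetrad a b y d"
  "antitetrad a b c (x + y) = antitetrad a b c x + antitetrad a b c y"
  by (simp_all add: antitetrad_def matrix_add_mult matrix_add_ldistrib)

lemma antitetrad_scale:
  "antitetrad (mat_scale q x) b c d = mat_scale q (antitetrad x b c d)"
  "antitetrad a (mat_scale q x) c d = mat_scale q (antitetrad a x c d)"
  "antitetrad a b (mat_scale q x) d = mat_scale q (antitetrad a b x d)"
  "antitetrad a b c (mat_scale q x) = mat_scale q (antitetrad a b c x)"
  by (simp_all add: antitetrad_def mat_scale_mult matQ.scale_right_diff_distrib)

definition relator where
  "relator a b c d = L a * (L b * (L c * L d)) - L d * (L c * (L b * L a)) - L (antitetrad a b c d)"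

lemmas relator_simps = relator_def antitetrad_add antitetrad_scale L_add L_scale antitetrad_C111
  distrib_left distrib_right right_diff_distrib mult.assoc const_left_commute

text \<open>The ideal is generated by relators of basis elements. A relator is linear in each
  argument, so the four arguments are freed one after another, from left to right.\<close>

lemma relator_mem:
  assumes "a \<in> C111" "b \<in> C111" "c \<in> C111" "d \<in> C111"
  shows "relator a b c d \<in> I"
proof -
  have 0: "relator a b c d \<in> I" if "a \<in> B" "b \<in> B" "c \<in> B" "d \<in> B" for a b c d
  proof -
    have "relator a b c d \<in> env_relators B"
      using that unfolding env_relators_def relator_def by (auto simp: L_basis mult.assoc)
    then show ?thesis using F.genideal_self[OF relators_in_F] by blast
  qed
  have 1: "relator a b c d \<in> I" if "a \<in> C111" "b \<in> B" "c \<in> B" "d \<in> B" for a b c d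
    using that(1) by (rule span_induct_linear[where f = "\<lambda>x. relator x b c d"])
      ((use that in \<open>simp add: 0 basis_subset\<close>),
        (use that in \<open>simp_all add: relator_simps basis_subset\<close>))
  have 2: "relator a b c d \<in> I" if "a \<in> C111" "b \<in> C111" "c \<in> B" "d \<in> B" for a b c d
    using that(2) by (rule span_induct_linear[where f = "\<lambda>x. relator a x c d"])
      ((use that in \<open>simp add: 1 basis_subset\<close>),
        (use that in \<open>simp_all add: relator_simps basis_subset\<close>))
  have 3: "relator a b c d \<in> I" if "a \<in> C111" "b \<in> C111" "c \<in> C111" "d \<in> B" for a b c d
    using that(3) by (rule span_induct_linear[where f = "\<lambda>x. relator a b x d"])
      ((use that in \<open>simp add: 2 basis_subset\<close>),
        (use that in \<open>simp_all add: relator_simps basis_subset\<close>))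
  show ?thesis
    using assms(4) by (rule span_induct_linear[where f = "\<lambda>x. relator a b c x"])
      ((use assms in \<open>simp add: 3 basis_subset\<close>),
        (use assms in \<open>simp_all add: relator_simps basis_subset\<close>))
qed

lemma quotient_cyclic_tetrad: "cyclic_tetrad (F Quot I) (\<lambda>k. I +>\<^bsub>F\<^esub> L (cyc_mat k))"
proof (rule cyclic_tetradI)
  show "ring (F Quot I)" by (rule I.quotient_is_ring)
  interpret h: ring_hom_ring F "F Quot I" "(+>\<^bsub>F\<^esub>) I" by (rule I.rcos_ring_hom_ring)
  show "I +>\<^bsub>F\<^esub> L x \<in> carrier (F Quot I)" for x by (rule h.hom_closed[OF L_closed])
  show "I +>\<^bsub>F\<^esub> L 0 = \<zero>\<^bsub>F Quot I\<^esub>"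
    using h.hom_zero by (simp add: L_zero)
  fix a b c d
  assume abcd: "a \<in> C111" "b \<in> C111" "c \<in> C111" "d \<in> C111"
  have closed: "L a * (L b * (L c * L d)) \<in> carrier F"
    "L d * (L c * (L b * L a)) + L (antitetrad a b c d) \<in> carrier F"
    by (intro F_mult F_add L_closed)+
  have "L a * (L b * (L c * L d)) - (L d * (L c * (L b * L a)) + L (antitetrad a b c d)) \<in> I"
    using relator_mem[OF abcd] by (simp add: relator_def algebra_simps)
  then have "I +>\<^bsub>F\<^esub> (L a \<otimes>\<^bsub>F\<^esub> (L b \<otimes>\<^bsub>F\<^esub> (L c \<otimes>\<^bsub>F\<^esub> L d))) =
      I +>\<^bsub>F\<^esub> (L d \<otimes>\<^bsub>F\<^esub> (L c \<otimes>\<^bsub>F\<^esub> (L b \<otimes>\<^bsub>F\<^esub> L a)) \<oplus>\<^bsub>F\<^esub> L (antitetrad a b c d))"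
    using coset_eq_iff[OF closed] by simp
  then show "(I +>\<^bsub>F\<^esub> L a) \<otimes>\<^bsub>F Quot I\<^esub> ((I +>\<^bsub>F\<^esub> L b) \<otimes>\<^bsub>F Quot I\<^esub> ((I +>\<^bsub>F\<^esub> L c) \<otimes>\<^bsub>F Quot I\<^esub> (I +>\<^bsub>F\<^esub> L d))) =
      (I +>\<^bsub>F\<^esub> L d) \<otimes>\<^bsub>F Quot I\<^esub> ((I +>\<^bsub>F\<^esub> L c) \<otimes>\<^bsub>F Quot I\<^esub> ((I +>\<^bsub>F\<^esub> L b) \<otimes>\<^bsub>F Quot I\<^esub> (I +>\<^bsub>F\<^esub> L a))) \<oplus>\<^bsub>F Quot I\<^esub>
      (I +>\<^bsub>F\<^esub> L (antitetrad a b c d))"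
    by (simp only: h.hom_mult h.hom_add L_closed F.m_closed F.a_closed)
qed

section \<open>Lifting the units to the free algebra\<close>

lemma F_neg: "x \<in> carrier F \<Longrightarrow> \<ominus>\<^bsub>F\<^esub> x = - x"
  using free_alg_minus(1)[of x B x] by simp

text \<open>Representatives of the two families of units; the coset of \<open>E' i j\<close> is
  \<open>Q.cocyc_unit i j\<close>, and the negated indices are those of the mirrored family.\<close>

definition "E i j = cyc_unit F (\<lambda>k. L (cyc_mat k)) i j"
definition "E' i j = cyc_unit F (\<lambda>k. \<ominus>\<^bsub>F\<^esub> L (cyc_mat (2 - k))) (- i) (- j)"

lemma E_closed [simp]: "E i j \<in> carrier F" and E'_closed [simp]: "E' i j \<in> carrier F"
  unfolding E_def E'_def by (intro F.cyc_unit_in_carrier F.a_inv_closed L_closed)+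

interpretation h: ring_hom_ring F "F Quot I" "(+>\<^bsub>F\<^esub>) I" by (rule I.rcos_ring_hom_ring)
interpretation Q: cyclic_tetrad "F Quot I" "\<lambda>k. I +>\<^bsub>F\<^esub> L (cyc_mat k)"
  by (rule quotient_cyclic_tetrad)

lemma coset_E: "I +>\<^bsub>F\<^esub> E i j = cyc_unit (F Quot I) (\<lambda>k. I +>\<^bsub>F\<^esub> L (cyc_mat k)) i j"
  unfolding E_def by (rule cyc_unit_hom[OF h.homh L_closed F.ring_axioms])

lemma coset_E': "I +>\<^bsub>F\<^esub> E' i j = Q.cocyc_unit i j"
proof -
  have "I +>\<^bsub>F\<^esub> E' i j = cyc_unit (F Quot I) (\<lambda>k. I +>\<^bsub>F\<^esub> (\<ominus>\<^bsub>F\<^esub> L (cyc_mat (2 - k)))) (- i) (- j)"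
    unfolding E'_def by (rule cyc_unit_hom[OF h.homh F.a_inv_closed[OF L_closed] F.ring_axioms])
  then show ?thesis
    unfolding Q.cocyc_unit_def by (simp only: h.hom_a_inv L_closed)
qed

text \<open>The identity in the quotient ring is pulled back to a congruence modulo
  \<open>I\<close>, since the spanning argument needs the scalars of the free algebra.\<close>

lemma gen_mult_E: "L (cyc_mat k) * E i j - (if i = k then E (k + 1) j else 0) \<in> I"
proof -
  have "I +>\<^bsub>F\<^esub> (L (cyc_mat k) \<otimes>\<^bsub>F\<^esub> E i j) = I +>\<^bsub>F\<^esub> (if i = k then E (k + 1) j else \<zero>\<^bsub>F\<^esub>)"
    using Q.gen_mult_cyc_unit[of k i j]
    by (cases "i = k") (simp_all only: h.hom_mult L_closed E_closed coset_E[symmetric] h.hom_zero simp_thms if_True if_False)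
  then show ?thesis
    by (subst coset_eq_iff[symmetric]) (auto simp del: free_alg_simps(1) intro!: F_mult F_zero)
qed

lemma gen_mult_E': "L (cyc_mat k) * E' i j - (if i = k + 1 then - E' k j else 0) \<in> I"
proof -
  have "I +>\<^bsub>F\<^esub> (L (cyc_mat k) \<otimes>\<^bsub>F\<^esub> E' i j) = I +>\<^bsub>F\<^esub> (if i = k + 1 then \<ominus>\<^bsub>F\<^esub> E' k j else \<zero>\<^bsub>F\<^esub>)"
    using Q.gen_mult_cocyc_unit[of k i j]
    by (cases "i = k + 1") (simp_all only: h.hom_mult L_closed E'_closed coset_E'[symmetric] h.hom_zero h.hom_a_inv simp_thms if_True if_False)
  then show ?thesis
    using F_neg[OF E'_closed, of k j] F.a_inv_closed[OF E'_closed, of k j]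
    by (subst coset_eq_iff[symmetric]) (auto simp del: free_alg_simps(1) intro!: F_mult F_zero)
qed

lemma gen_decomp_E: "L (cyc_mat k) - (E (k + 1) k - E' k (k + 1)) \<in> I"
proof -
  have "I +>\<^bsub>F\<^esub> L (cyc_mat k) = I +>\<^bsub>F\<^esub> (E (k + 1) k \<oplus>\<^bsub>F\<^esub> \<ominus>\<^bsub>F\<^esub> E' k (k + 1))"
    using Q.gen_decomp[of k]
    by (simp only: h.hom_add h.hom_a_inv F.a_inv_closed E_closed E'_closed coset_E coset_E' a_minus_def)
  then show ?thesis
    using F_neg[OF E'_closed, of k "k + 1"]
    by (subst coset_eq_iff[symmetric]) (auto simp del: free_alg_simps(1) intro!: F_diff)
qed

section \<open>Images of the units in the target algebra\<close>

lemma env_map_add: "env_map (p + q) = env_map p + env_map q"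
  and env_map_diff: "env_map (p - q) = env_map p - env_map q"
  and env_map_sum: "env_map (sum f A) = (\<Sum>x\<in>A. env_map (f x))"
  and env_map_mult: "env_map (p * q) = target_mult (env_map p) (env_map q)"
  and env_map_const: "env_map (const c * p) = target_scale c (env_map p)"
  and env_map_one: "env_map 1 = (1, mat 1, mat 1)"
  and env_map_zero: "env_map 0 = 0"
  unfolding env_map_def
  by (simp_all only: T.eval_add T.eval_diff T.eval_sum T.eval_mult T.eval_const T.m_scale T.m_units T.eval_1 T.eval_0)

interpretation phi: ring_hom_ring F target_alg env_map by (rule env_map_hom)

lemma env_map_L_cyc: "env_map (L (cyc_mat k)) = (0, cyc_mat k, - mat_unit k (k + 1))"
  by (simp add: env_map_L cotranspose_def)

text \<open>Every word in \<open>cyc_unit\<close> ends in the generators \<open>j + 1\<close> and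
  \<open>j\<close>. In the second block these become multiples of E(j + 1, j + 2) and E(j, j + 1),
  whose product is zero, so only the first block survives.\<close>

lemma env_map_E: "env_map (E i j) = (0, mat_unit i j, 0)"
proof -
  have "env_map (E i j) = cyc_unit target_alg (\<lambda>k. (0, cyc_mat k, - mat_unit k (k + 1))) i j"
    unfolding E_def env_map_L_cyc[symmetric] by (rule cyc_unit_hom[OF phi.homh L_closed F.ring_axioms])
  also have "\<dots> = (0, mat_unit i j, 0)"
    using index_cases[of i j]
    by (elim disjE)
      (simp_all add: cyc_unit_def target_alg_simps mat_unit_mult matrix_minus_mult add.assoc)
  finally show ?thesis .
qed

lemma env_map_E': "env_map (E' i j) = (0, 0, mat_unit i j)"
proof -
  \<comment> \<open>Since \<open>2 - k = - (k + 1)\<close>, the second block carries the cyclic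
    generator with negated indices; the arguments \<open>- i\<close> and \<open>- j\<close> undo the
    negation.\<close>
  have "env_map (\<ominus>\<^bsub>F\<^esub> L (cyc_mat (2 - k))) = (0, - mat_unit (- k) (2 - k), mat_unit (2 - k) (- k))" for k
  proof -
    have "2 - k + 1 = - k" by (simp add: algebra_simps)
    then have "env_map (L (cyc_mat (2 - k))) = (0, mat_unit (- k) (2 - k), - mat_unit (2 - k) (- k))"
      unfolding env_map_L_cyc by simp
    then show ?thesis
      using F_neg[OF L_closed, of "cyc_mat (2 - k)"] env_map_diff[of 0 "L (cyc_mat (2 - k))"]
      by (simp add: env_map_zero zero_prod_def)
  qed
  then have "env_map (E' i j) =
      cyc_unit target_alg (\<lambda>k. (0, - mat_unit (- k) (2 - k), mat_unit (2 - k) (- k))) (- i) (- j)"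
    unfolding E'_def using cyc_unit_hom[OF phi.homh F.a_inv_closed[OF L_closed] F.ring_axioms] by simp
  also have "\<dots> = (0, 0, mat_unit i j)"
    using exhaust_3[of i] exhaust_3[of j]
    by (elim disjE)
      (simp_all add: cyc_unit_def target_alg_simps mat_unit_mult matrix_minus_mult)
  finally show ?thesis .
qed

lemma env_map_ideal: "p \<in> I \<Longrightarrow> env_map p = 0"
proof -
  have "env_relators B \<subseteq> a_kernel F target_alg env_map"
  proof
    fix r assume r: "r \<in> env_relators B"
    then obtain a b c d where abcd: "a \<in> B" "b \<in> B" "c \<in> B" "d \<in> B"
      and "r = gen a * gen b * gen c * gen d - gen d * gen c * gen b * gen a - L (antitetrad a b c d)"
      unfolding env_relators_def by blast
    then have "r = L a * L b * L c * L d - L d * L c * L b * L a - L (antitetrad a b c d)"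
      by (simp add: L_basis)
    then have "env_map r = 0"
      using abcd[THEN basis_subset]
      by (simp add: env_map_diff env_map_mult env_map_L antitetrad_C111 cotranspose_antitetrad zero_prod_def)
        (simp add: antitetrad_def)
    then show "r \<in> a_kernel F target_alg env_map"
      using subsetD[OF relators_in_F r] unfolding a_kernel_def' target_alg_simps by blast
  qed
  then have "I \<subseteq> a_kernel F target_alg env_map"
    by (intro F.genideal_minimal phi.kernel_is_ideal)
  then show "p \<in> I \<Longrightarrow> env_map p = 0"
    unfolding a_kernel_def' target_alg_simps by blast
qed

section \<open>Spanning the free algebra modulo the ideal\<close>

abbreviation "env_span \<equiv> polyQ.span (insert 1 (range (\<lambda>(i, j). E i j) \<union> range (\<lambda>(i, j). E' i j) \<union> I))"

lemma env_span_base: "E i j \<in> env_span" "E' i j \<in> env_span" "p \<in> I \<Longrightarrow> p \<in> env_span" "1 \<in> env_span"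
  by (rule polyQ.span_base; force)+

text \<open>Modulo \<open>I\<close> a unit goes to zero or, up to sign, to another unit, and 1 goes
  to a generator, which is a difference of two units by \<open>gen_decomp_E\<close>. The ideal
  itself absorbs left multiplication.\<close>

lemma env_span_cyc_mult: "p \<in> env_span \<Longrightarrow> L (cyc_mat k) * p \<in> env_span"
proof (induction p rule: polyQ.span_induct)
  case base
  show ?case
    by (rule polyQ.subspaceI) (simp_all add: polyQ.span_zero polyQ.span_add distrib_left const_left_commute polyQ.span_scale)
next
  case (step p)
  have mod: "x \<in> env_span" if "x - y \<in> I" "y \<in> env_span" for x y
    using polyQ.span_add[OF env_span_base(3)[OF that(1)] that(2)] by simp
  have E: "L (cyc_mat k) * E i j \<in> env_span" for i j
    by (rule mod[OF gen_mult_E]) (simp add: env_span_base polyQ.span_zero)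
  have E': "L (cyc_mat k) * E' i j \<in> env_span" for i j
    by (rule mod[OF gen_mult_E']) (simp add: env_span_base polyQ.span_zero polyQ.span_neg)
  have "L (cyc_mat k) \<in> env_span"
    by (rule mod[OF gen_decomp_E]) (simp add: env_span_base polyQ.span_diff)
  then show ?case
    using step E E' env_span_base(3)[OF I_left[OF _ L_closed]] by auto
qed

lemma L_decomp: "x \<in> C111 \<Longrightarrow> L x = (\<Sum>k\<in>UNIV. const (x $ (k + 1) $ k) * L (cyc_mat k))"
proof -
  assume x: "x \<in> C111"
  define m where "m = (\<lambda>k. cyc_mat k)"
  have "m k \<in> C111" for k by (simp add: m_def)
  then have "L (\<Sum>k\<in>UNIV. mat_scale (x $ (k + 1) $ k) (m k)) = (\<Sum>k\<in>UNIV. const (x $ (k + 1) $ k) * L (m k))"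
    by (simp add: sum_3 L_add L_scale C111_scale C111_add)
  then have "L x = (\<Sum>k\<in>UNIV. const (x $ (k + 1) $ k) * L (m k))"
    using C111_decomp[OF x] by (simp only: m_def)
  then show ?thesis by (simp only: m_def)
qed

lemma env_span_gen_mult: "\<lbrakk>b \<in> B; p \<in> env_span\<rbrakk> \<Longrightarrow> gen b * p \<in> env_span"
  unfolding L_basis[symmetric] L_decomp[OF basis_subset] sum_distrib_right mult.assoc
  by (intro polyQ.span_sum polyQ.span_scale env_span_cyc_mult)

lemma monomial_in_env_span: "set l \<subseteq> B \<Longrightarrow> Poly_Mapping.single (Word l) c \<in> env_span"
proof (induction l)
  case Nil
  have "const c * 1 \<in> env_span"
    by (intro polyQ.span_scale env_span_base)
  then show ?case by (simp add: zero_word_def)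
next
  case (Cons b l)
  have "Poly_Mapping.single (Word (b # l)) c = gen b * Poly_Mapping.single (Word l) c"
    by (simp add: gen_def mult_single plus_word_def)
  then show ?case
    using Cons by (simp add: env_span_gen_mult)
qed

text \<open>Hence 1 and the two families of nine units span the quotient, nineteen elements against
  the dimension 1 + 9 + 9 of the target.\<close>

lemma F_subset_env_span: "p \<in> carrier F \<Longrightarrow> p \<in> env_span"
  by (induction p rule: free_alg_induct)
    (simp_all add: monomial_in_env_span polyQ.span_zero polyQ.span_add)

section \<open>A linear section of the evaluation map\<close>

definition unit_comb :: "(3 \<Rightarrow> 3 \<Rightarrow> (rat^3^3) word \<Rightarrow>\<^sub>0 rat) \<Rightarrow> rat^3^3 \<Rightarrow> (rat^3^3) word \<Rightarrow>\<^sub>0 rat" where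
  "unit_comb X A = (\<Sum>i\<in>UNIV. \<Sum>j\<in>UNIV. const (A $ i $ j) * X i j)"

lemma unit_comb_add: "unit_comb X (A + C) = unit_comb X A + unit_comb X C"
  by (simp add: unit_comb_def single_add distrib_right sum.distrib)

lemma unit_comb_scale: "unit_comb X (mat_scale c A) = const c * unit_comb X A"
  by (simp add: unit_comb_def mat_scale_def sum_distrib_left mult_single flip: mult.assoc)

lemma unit_comb_zero: "unit_comb X 0 = 0"
  by (simp add: unit_comb_def)

lemma unit_comb_mat_unit: "unit_comb X (mat_unit k l) = X k l"
proof -
  have "(\<Sum>j\<in>UNIV. const (mat_unit k l $ i $ j) * X i j) = (if i = k then X k l else 0)" for i
    by (cases "i = k")
      (simp_all add: mat_unit_def if_distrib[of const] if_distrib[of "\<lambda>x. x * _"] cong: if_cong)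
  then show ?thesis by (simp add: unit_comb_def)
qed

text \<open>The idempotent of the one-dimensional summand is \<open>1\<close> minus the two block identities;
  this is where the subtraction of \<open>q\<close> on the diagonals comes from.\<close>

fun section_map :: "target \<Rightarrow> (rat^3^3) word \<Rightarrow>\<^sub>0 rat" where
  "section_map (q, A, C) =
     const q + (unit_comb E (A - mat_scale q (mat 1)) + unit_comb E' (C - mat_scale q (mat 1)))"

lemma section_map_closed: "section_map t \<in> carrier F"
  by (cases t rule: prod_cases3)
    (simp only: section_map.simps unit_comb_def, intro F_add F_sum F_mult const_in_free_alg E_closed E'_closed)

lemma section_map_add: "section_map (s + t) = section_map s + section_map t"
proof -
  have eq: "(A + C) - mat_scale (x + y) (mat 1) = (A - mat_scale x (mat 1)) + (C - mat_scale y (mat 1))"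
    for A C :: "rat^3^3" and x y
    by (simp add: matQ.scale_left_distrib)
  show ?thesis
    by (cases s rule: prod_cases3; cases t rule: prod_cases3)
      (simp only: add_Pair section_map.simps eq unit_comb_add single_add ac_simps)
qed

lemma section_map_scale: "section_map (target_scale c t) = const c * section_map t"
proof -
  have eq: "mat_scale c A - mat_scale (c * x) (mat 1) = mat_scale c (A - mat_scale x (mat 1))"
    for A :: "rat^3^3" and x
    by (simp add: matQ.scale_right_diff_distrib)
  have const_mult: "const (c * x) = const c * const x" for x :: rat
    by (simp add: mult_single)
  show ?thesis
    by (cases t rule: prod_cases3)
      (simp only: target_scale.simps section_map.simps eq const_mult unit_comb_scale distrib_left)
qed

text \<open>Both maps are linear, so spanning elements suffice: 1 and the units are reproduced
  exactly, and elements of \<open>I\<close> are sent to 0. This gives injectivity of the evaluation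
  modulo \<open>I\<close>.\<close>

lemma section_env_map: "p \<in> env_span \<Longrightarrow> section_map (env_map p) - p \<in> I"
proof (induction p rule: polyQ.span_induct)
  case base
  show ?case
  proof (rule polyQ.subspaceI)
    show "0 \<in> {p. section_map (env_map p) - p \<in> I}"
      using section_map_scale[of 0 0] by (simp add: env_map_zero zero_prod_def I_zero)
  next
    fix p q
    assume "p \<in> {p. section_map (env_map p) - p \<in> I}" "q \<in> {p. section_map (env_map p) - p \<in> I}"
    then have "(section_map (env_map p) - p) + (section_map (env_map q) - q) \<in> I"
      by (intro I_add) auto
    then show "p + q \<in> {p. section_map (env_map p) - p \<in> I}"
      by (simp add: env_map_add section_map_add algebra_simps)
  next
    fix c p
    assume "p \<in> {p. section_map (env_map p) - p \<in> I}"
    then have "const c * (section_map (env_map p) - p) \<in> I"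
      by (intro I_left const_in_free_alg) auto
    then show "const c * p \<in> {p. section_map (env_map p) - p \<in> I}"
      by (simp add: env_map_const section_map_scale right_diff_distrib)
  qed
next
  case (step p)
  then consider "p = 1" | i j where "p = E i j" | i j where "p = E' i j" | "p \<in> I"
    by auto
  then show ?case
  proof cases
    case 1
    then show ?thesis
      by (simp add: env_map_one unit_comb_zero I_zero)
  next
    case (2 i j)
    then show ?thesis
      by (simp add: env_map_E unit_comb_mat_unit unit_comb_zero I_zero)
  next
    case (3 i j)
    then show ?thesis
      by (simp add: env_map_E' unit_comb_mat_unit unit_comb_zero I_zero)
  next
    case 4
    then have "const (- 1) * p \<in> I"
      by (intro I_left const_in_free_alg)
    then show ?thesis
      using 4 section_map_scale[of 0 0] by (simp add: env_map_ideal zero_prod_def single_uminus)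
  qed
qed

text \<open>The term \<open>const q\<close> contributes \<open>q\<close> times the identity to each
  block, and the diagonal correction in \<open>section_map\<close> cancels it.\<close>

lemma env_map_section: "env_map (section_map t) = t"
proof -
  obtain q A C where t: "t = (q, A, C)" by (cases t rule: prod_cases3)
  have "env_map (const q) = target_scale q (1, mat 1, mat 1)"
    using env_map_const[of q 1] by (simp add: env_map_one)
  moreover have "(\<Sum>i\<in>UNIV. \<Sum>j\<in>UNIV. mat_scale (X $ i $ j) (mat_unit i j)) = X" for X :: "rat^3^3"
    by (simp add: vec_eq_iff forall_3 sum_3 mat_scale_def mat_unit_def)
  then have "env_map (unit_comb E X) = (0, X, 0)" "env_map (unit_comb E' X) = (0, 0, X)" for X
    by (simp_all add: unit_comb_def env_map_sum env_map_const env_map_E env_map_E' sum_prod)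
  ultimately show ?thesis
    by (simp add: t env_map_add)
qed

lemma env_map_surj: "env_map ` carrier F = carrier target_alg"
proof -
  have "t \<in> env_map ` carrier F" for t
    by (rule image_eqI[where x = "section_map t"]) (simp_all only: env_map_section section_map_closed)
  then show ?thesis
    unfolding target_alg_simps by blast
qed

text \<open>If \<open>p\<close> evaluates to 0, then \<open>section_env_map\<close> places
  \<open>- p\<close> in \<open>I\<close>; the converse is \<open>env_map_ideal\<close>.\<close>

lemma kernel_env_map: "a_kernel F target_alg env_map = I"
proof (intro equalityI subsetI)
  fix p assume "p \<in> a_kernel F target_alg env_map"
  then have p: "p \<in> carrier F" "env_map p = 0"
    unfolding a_kernel_def' target_alg_simps by blast+
  have "section_map 0 = 0"
    using section_map_scale[of 0 0] by (simp add: zero_prod_def)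
  then have "- p \<in> I"
    using section_env_map[OF F_subset_env_span[OF p(1)]] p(2) by simp
  then have "const (- 1) * - p \<in> I"
    by (intro I_left const_in_free_alg)
  then show "p \<in> I"
    by (simp add: single_uminus)
next
  fix p assume "p \<in> I"
  then show "p \<in> a_kernel F target_alg env_map"
    using I_subset env_map_ideal unfolding a_kernel_def' target_alg_simps by blast
qed

section \<open>The induced isomorphism of algebras\<close>

lemma univ_env_simps:
  "carrier (univ_env B) = carrier (F Quot I)" "mult (univ_env B) = mult (F Quot I)"
  "one (univ_env B) = one (F Quot I)" "add (univ_env B) = add (F Quot I)"
  "q \<odot>\<^bsub>univ_env B\<^esub> X = (\<Union>x\<in>X. I +>\<^bsub>F\<^esub> (q \<odot>\<^bsub>F\<^esub> x))"
  by (simp_all add: univ_env_def alg_quot_def ring.defs module.defs)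

lemma image_coset: "p \<in> carrier F \<Longrightarrow> env_map ` (I +>\<^bsub>F\<^esub> p) = {env_map p}"
proof -
  have "env_map (i + p) = env_map p" if "i \<in> I" for i
    using that by (simp add: env_map_add env_map_ideal)
  moreover have "I +>\<^bsub>F\<^esub> p = (\<lambda>i. i + p) ` I"
    unfolding a_r_coset_def' by auto
  ultimately show ?thesis
    using I_zero by auto
qed

lemma univ_env_iso: "alg_isomorphic (univ_env B) target_alg"
  unfolding alg_isomorphic_def is_alg_iso_def
proof (intro exI conjI allI ballI)
  let ?h = "\<lambda>X. the_elem (env_map ` X)"
  \<comment> \<open>The first isomorphism theorem gives the ring isomorphism; compatibility with
    scalars is checked separately below.\<close>
  have "?h \<in> ring_iso (F Quot I) target_alg"
    using phi.FactRing_iso_set[OF env_map_surj] unfolding kernel_env_map .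
  then show "?h \<in> ring_iso (univ_env B) target_alg"
    unfolding ring_iso_def ring_hom_def univ_env_simps by simp
  fix q X
  assume "X \<in> carrier (univ_env B)"
  then obtain p where p: "p \<in> carrier F" "X = I +>\<^bsub>F\<^esub> p"
    unfolding univ_env_simps by (auto simp: FactRing_def A_RCOSETS_def')
  \<comment> \<open>The scalar multiple of a coset is a union over its representatives, so all of
    them must be shown to have the same image.\<close>
  have X: "x \<in> carrier F \<and> env_map x = env_map p" if "x \<in> X" for x
  proof
    show "x \<in> carrier F"
      using that I_subset p unfolding a_r_coset_def' by (force simp del: free_alg_simps(1) intro: F_add)
    show "env_map x = env_map p"
      using that image_coset[OF p(1)] p(2) by blast
  qed
  have "env_map ` (I +>\<^bsub>F\<^esub> (q \<odot>\<^bsub>F\<^esub> x)) = {target_scale q (env_map p)}" if "x \<in> X" for x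
    using X[OF that] image_coset[of "const q * x"] F_mult[OF const_in_free_alg, of x q]
    by (simp add: env_map_const)
  \<comment> \<open>An empty union would have an empty image, for which \<open>the_elem\<close> says
    nothing.\<close>
  moreover have "X \<noteq> {}"
    using image_coset[OF p(1)] p(2) by auto
  ultimately have "env_map ` (\<Union>x\<in>X. I +>\<^bsub>F\<^esub> (q \<odot>\<^bsub>F\<^esub> x)) = {target_scale q (env_map p)}"
    by (simp only: image_UN) auto
  then show "?h (q \<odot>\<^bsub>univ_env B\<^esub> X) = q \<odot>\<^bsub>target_alg\<^esub> ?h X"
    unfolding univ_env_simps target_alg_simps p(2) image_coset[OF p(1)] by simp
qed

end

theorem proposition8p7:
  shows
    "(\<forall>B. matQ.independent B \<and> matQ.span B = C111 \<longrightarrow>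
        alg_isomorphic (univ_env B)
          (alg_sum rat_alg
            (alg_sum (mat_alg :: (rat, rat^3^3) module) (mat_alg :: (rat, rat^3^3) module)))) \<and>
     irreducible_rep C111 (*) trivial_rep \<and>
     irreducible_rep C111 (*s) natural_rep \<and>
     (\<exists>\<sigma> :: rat^3^3 \<Rightarrow> rat^3 \<Rightarrow> rat^3.
        irreducible_rep C111 (*s) \<sigma> \<and> \<not> rep_isomorphic C111 (*s) natural_rep (*s) \<sigma>) \<and>
     (\<forall>\<sigma> :: rat^3^3 \<Rightarrow> rat^3 \<Rightarrow> rat^3.
        irreducible_rep C111 (*s) \<sigma> \<and> \<not> rep_isomorphic C111 (*s) natural_rep (*s) \<sigma> \<longrightarrow>
        (\<forall>(s :: rat \<Rightarrow> 'v \<Rightarrow> 'v::ab_group_add) \<rho>.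
           (\<exists>E. finite_dimensional_vector_space s E) \<and> irreducible_rep C111 s \<rho> \<longrightarrow>
             rep_isomorphic C111 s \<rho> (*) trivial_rep \<or>
             rep_isomorphic C111 s \<rho> (*s) natural_rep \<or>
             rep_isomorphic C111 s \<rho> (*s) \<sigma>))"
proof (intro conjI allI impI)
  fix B :: "(rat^3^3) set"
  assume "matQ.independent B \<and> matQ.span B = C111"
  then interpret C111_basis B by unfold_locales auto
  show "alg_isomorphic (univ_env B) target_alg" by (rule univ_env_iso)
next
  show "irreducible_rep C111 (*) trivial_rep" by (rule irreducible_trivial)
  show "irreducible_rep C111 (*s) natural_rep" by (rule irreducible_natural)
  show "\<exists>\<sigma> :: rat^3^3 \<Rightarrow> rat^3 \<Rightarrow> rat^3.
      irreducible_rep C111 (*s) \<sigma> \<and> \<not> rep_isomorphic C111 (*s) natural_rep (*s) \<sigma>"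
    using irreducible_cotranspose natural_not_isomorphic_cotranspose by blast
next
  fix \<sigma> :: "rat^3^3 \<Rightarrow> rat^3 \<Rightarrow> rat^3" and s :: "rat \<Rightarrow> 'v \<Rightarrow> 'v" and \<rho>
  assume \<sigma>: "irreducible_rep C111 (*s) \<sigma> \<and> \<not> rep_isomorphic C111 (*s) natural_rep (*s) \<sigma>"
    and \<rho>: "(\<exists>E. finite_dimensional_vector_space s E) \<and> irreducible_rep C111 s \<rho>"
  \<comment> \<open>The classification is applied to \<open>\<sigma>\<close> itself: the natural
    case is excluded by assumption and the trivial case by dimension.\<close>
  have "rep_isomorphic C111 (*s) \<sigma> (*s) cotranspose_rep"
    using irreducible_rep_C111_classification[of "(*s)" \<sigma>] \<sigma> trivial_not_isomorphic_3
      rep_isomorphic_sym by blast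
  then have "rep_isomorphic C111 (*s) cotranspose_rep (*s) \<sigma>"
    by (rule rep_isomorphic_sym)
  then show "rep_isomorphic C111 s \<rho> (*) trivial_rep \<or>
      rep_isomorphic C111 s \<rho> (*s) natural_rep \<or> rep_isomorphic C111 s \<rho> (*s) \<sigma>"
    using irreducible_rep_C111_classification[of s \<rho>] \<rho> rep_isomorphic_trans by blast
qed

end
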